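(* Let $\mathcal{H}$ be a complex Hilbert space and let $\mathcal{T}:\mathbb{R}\to B(\mathcal{H})$ be a strongly continuous isometric representation such that its Beurling spectrum satisfies $\Lambda(\mathcal{H},\mathcal{T})\subseteq[-\gamma,\gamma]$ for some $\gamma>0$. Assume that a vector $x\in\mathcal{H}$ and a set $\Gamma=\{\gamma_n:n\in\mathbb{Z}\}\subset\mathbb{R}$ are such that the system of vectors $\{\mathcal{T}(\gamma_n)x\}_{n\in\mathbb{Z}}$ forms a Riesz basis for $\mathcal{H}$ with bounds $B\ge A>0$. Then $\kappa:=\inf\{|\gamma_m-\gamma_n|:m,n\in\mathbb{Z},\ m\ne n\}$ satisfies $$2\left(1-\cos\frac{\gamma\kappa}{2}\right)\left(1+\sin\frac{\gamma\kappa}{2}\right)\ge\frac AB\quad\text{or}\quad\kappa\ge\frac{\pi}{2\gamma}.$$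
   Context: $B(\mathcal{H})$ denotes the algebra of bounded linear operators on $\mathcal{H}$. A representation $\mathcal{T}:\mathbb{R}\to B(\mathcal{H})$ satisfies $\mathcal{T}(0)=I$ and $\mathcal{T}(s+t)=\mathcal{T}(s)\mathcal{T}(t)$; it is isometric if every $\mathcal{T}(t)$ is an isometry, and strongly continuous if $t\mapsto\mathcal{T}(t)y$ is continuous for every $y\in\mathcal{H}$. For $f\in L^1(\mathbb{R})$ and $y\in\mathcal{H}$ put $fy=\int_{\mathbb{R}}f(t)\mathcal{T}(-t)y\,dt$ (Bochner integral), and let $\widehat f(\xi)=\int_{\mathbb{R}}f(t)e^{-it\xi}\,dt$. The Beurling spectrum is $$\Lambda(\mathcal{H},\mathcal{T})=\{\lambda\in\mathbb{R}:\ \text{if } f\in L^1(\mathbb{R}) \text{ and } fy=0 \text{ for all } y\in\mathcal{H},\text{ then } \widehat f(\lambda)=0\}.$$ A sequence $\{\varphi_n\}_{n\in\mathbb{Z}}$ in $\mathcal{H}$ is a Riesz basis for $\mathcal{H}$ with bounds $B\ge A>0$ if its linear span is dense in $\mathcal{H}$ and $A\|c\|_2^2\le\left\|\sum_{n\in\mathbb{Z}}c_n\varphi_n\right\|^2\le B\|c\|_2^2$ for all $c\in\ell^2(\mathbb{Z})$. *)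

theory Defs
  imports "HOL-Analysis.Analysis"
begin

section \<open>Complex Hilbert spaces\<close>

text \<open>The inner product is linear in its first argument.\<close>

class complex_inner = real_normed_vector +
  fixes scaleC :: "complex \<Rightarrow> 'a \<Rightarrow> 'a" (infixr "*\<^sub>C" 75)
    and cinner :: "'a \<Rightarrow> 'a \<Rightarrow> complex"
  assumes scaleC_add_right: "c *\<^sub>C (x + y) = c *\<^sub>C x + c *\<^sub>C y"
    and scaleC_add_left: "(c + d) *\<^sub>C x = c *\<^sub>C x + d *\<^sub>C x"
    and scaleC_scaleC: "c *\<^sub>C (d *\<^sub>C x) = (c * d) *\<^sub>C x"
    and scaleC_of_real: "complex_of_real r *\<^sub>C x = r *\<^sub>R x"
    and cinner_add_left: "cinner (x + y) z = cinner x z + cinner y z"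
    and cinner_scaleC_left: "cinner (c *\<^sub>C x) y = c * cinner x y"
    and cinner_commute: "cinner x y = cnj (cinner y x)"
    and cinner_self: "cinner x x = complex_of_real ((norm x)\<^sup>2)"

class chilbert_space = complex_inner + complete_space

instance chilbert_space \<subseteq> banach ..

instantiation complex :: chilbert_space
begin
definition "scaleC_complex (c::complex) (x::complex) = c * x"
definition "cinner_complex (x::complex) (y::complex) = x * cnj y"
instance
proof
  fix x :: complex
  show "cinner x x = complex_of_real ((norm x)\<^sup>2)"
    unfolding cinner_complex_def by (rule complex_norm_square [symmetric])
qed (simp_all add: scaleC_complex_def cinner_complex_def distrib_left distrib_right
    scaleR_conv_of_real)
end

lemma scaleC_one: "1 *\<^sub>C x = (x :: 'a::complex_inner)"
  using scaleC_of_real[of 1 x] by simp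

global_interpretation complex_vector:
  vector_space "scaleC :: complex \<Rightarrow> 'a \<Rightarrow> 'a::complex_inner"
  defines cspan = complex_vector.span
  by standard (simp_all add: scaleC_add_right scaleC_add_left scaleC_scaleC scaleC_one)


section \<open>Bochner integral\<close>

text \<open>
  \<^const>\<open>has_bochner_integral\<close> is restricted to second countable types. The following is the same
  definition for arbitrary normed spaces, so that no separability has to be imposed on the
  Hilbert space.
\<close>

definition has_bochner_integral_gen ::
    "'a measure \<Rightarrow> ('a \<Rightarrow> 'b::real_normed_vector) \<Rightarrow> 'b \<Rightarrow> bool" where
  "has_bochner_integral_gen M f x \<longleftrightarrow>
     f \<in> borel_measurable M \<and>
     (\<exists>s. (\<forall>i::nat. Bochner_Integration.simple_bochner_integrable M (s i)) \<and>
          (\<lambda>i. \<integral>\<^sup>+t. norm (f t - s i t) \<partial>M) \<longlonglongrightarrow> 0 \<and>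
          (\<lambda>i. Bochner_Integration.simple_bochner_integral M (s i)) \<longlonglongrightarrow> x)"

lemma has_bochner_integral_gen_iff:
  fixes f :: "'a \<Rightarrow> 'b::{real_normed_vector, second_countable_topology}"
  shows "has_bochner_integral_gen M f x \<longleftrightarrow> has_bochner_integral M f x"
proof
  assume "has_bochner_integral_gen M f x"
  then show "has_bochner_integral M f x"
    unfolding has_bochner_integral_gen_def by (auto intro: has_bochner_integral.intros)
next
  assume "has_bochner_integral M f x"
  then show "has_bochner_integral_gen M f x"
    by cases (auto simp: has_bochner_integral_gen_def)
qed


section \<open>Representations of the real line and the Beurling spectrum\<close>

definition bounded_clinear :: "('a::complex_inner \<Rightarrow> 'a) \<Rightarrow> bool" where
  "bounded_clinear f \<longleftrightarrow> bounded_linear f \<and> (\<forall>c x. f (c *\<^sub>C x) = c *\<^sub>C f x)"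

definition representation_on_reals :: "(real \<Rightarrow> 'a::complex_inner \<Rightarrow> 'a) \<Rightarrow> bool" where
  "representation_on_reals T \<longleftrightarrow>
     (\<forall>t. bounded_clinear (T t)) \<and> T 0 = id \<and> (\<forall>s t. T (s + t) = T s \<circ> T t)"

definition isometric_rep :: "(real \<Rightarrow> 'a::complex_inner \<Rightarrow> 'a) \<Rightarrow> bool" where
  "isometric_rep T \<longleftrightarrow> (\<forall>t y. norm (T t y) = norm y)"

definition strongly_continuous :: "(real \<Rightarrow> 'a::complex_inner \<Rightarrow> 'a) \<Rightarrow> bool" where
  "strongly_continuous T \<longleftrightarrow> (\<forall>y. continuous_on UNIV (\<lambda>t. T t y))"

definition fourier :: "(real \<Rightarrow> complex) \<Rightarrow> real \<Rightarrow> complex" where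
  "fourier f \<xi> = (LINT t|lborel. f t * exp (- (\<i> * complex_of_real (t * \<xi>))))"

text \<open>
  \<open>rep_action T f y z\<close> says \<open>f y = z\<close>, where \<open>f y\<close> is the Bochner integral of
  \<open>t \<mapsto> f(t) T(-t) y\<close>. For integrable \<open>f\<close> and a strongly continuous isometric \<open>T\<close> such a
  \<open>z\<close> exists and is unique.
\<close>

definition rep_action ::
    "(real \<Rightarrow> 'a::complex_inner \<Rightarrow> 'a) \<Rightarrow> (real \<Rightarrow> complex) \<Rightarrow> 'a \<Rightarrow> 'a \<Rightarrow> bool" where
  "rep_action T f y z \<longleftrightarrow> has_bochner_integral_gen lborel (\<lambda>t. f t *\<^sub>C T (- t) y) z"

definition beurling_spectrum :: "(real \<Rightarrow> 'a::complex_inner \<Rightarrow> 'a) \<Rightarrow> real set" where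
  "beurling_spectrum T =
     {\<mu>. \<forall>f. integrable lborel f \<and> (\<forall>y. rep_action T f y 0) \<longrightarrow> fourier f \<mu> = 0}"


section \<open>Riesz bases\<close>

text \<open>
  The series over all integers is taken as an unconditional sum; for a system satisfying the
  two-sided bound on finitely supported \<open>c\<close> it converges unconditionally for every
  square-summable \<open>c\<close>.
\<close>

definition riesz_basis :: "(int \<Rightarrow> 'a::complex_inner) \<Rightarrow> real \<Rightarrow> real \<Rightarrow> bool" where
  "riesz_basis \<phi> A B \<longleftrightarrow>
     0 < A \<and> A \<le> B \<and>
     closure (cspan (range \<phi>)) = UNIV \<and>
     (\<forall>c :: int \<Rightarrow> complex. (\<lambda>n. (cmod (c n))\<^sup>2) summable_on UNIV \<longrightarrow>
        (\<lambda>n. c n *\<^sub>C \<phi> n) summable_on UNIV \<and>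
        A * (\<Sum>\<^sub>\<infinity>n. (cmod (c n))\<^sup>2) \<le> (norm (\<Sum>\<^sub>\<infinity>n. c n *\<^sub>C \<phi> n))\<^sup>2 \<and>
        (norm (\<Sum>\<^sub>\<infinity>n. c n *\<^sub>C \<phi> n))\<^sup>2 \<le> B * (\<Sum>\<^sub>\<infinity>n. (cmod (c n))\<^sup>2))"

end

theory Submission
  imports Defs "HOL-Real_Asymp.Real_Asymp"
begin

text \<open>
  For a vector \<open>y\<close> the function \<open>\<rho>(t) = \<langle>T(t) y, y\<rangle>\<close> is continuous and positive definite, and every
  \<open>f\<close> annihilating the representation satisfies \<open>f * \<rho> = 0\<close>. Hence the spectral measure of \<open>\<rho>\<close>
  lives where all such \<open>f\<close> have vanishing Fourier transform, that is, in the Beurling spectrum, so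
  \<open>Re \<rho>(d) \<ge> cos(\<gamma> d) \<rho>(0)\<close> for \<open>0 \<le> \<gamma> d < \<pi>\<close>. Testing the Riesz inequalities on
  \<open>T(\<gamma>\<^sub>m) x \<plusminus> T(\<gamma>\<^sub>n) x\<close> with \<open>d = \<bar>\<gamma>\<^sub>m - \<gamma>\<^sub>n\<bar>\<close> and \<open>C = cos(\<gamma> d)\<close> gives
  \<open>A \<le> (1 - C) \<parallel>x\<parallel>\<^sup>2\<close> and \<open>(1 + C) \<parallel>x\<parallel>\<^sup>2 \<le> B\<close>, so \<open>A/B \<le> (1 - C)/(1 + C) = tan\<^sup>2(\<gamma> d / 2)\<close>.
  Bochner's theorem is avoided: the spectral measure is replaced by finitely supported measures
  whose Fourier transforms converge pointwise to \<open>\<rho>\<close>.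
\<close>

section \<open>Complex Hilbert spaces and Bochner integrals\<close>


lemma cinner_add_right: "cinner x (y + z) = cinner x y + cinner x (z::'a::complex_inner)"
  by (metis cinner_add_left cinner_commute complex_cnj_add)

lemma cinner_scaleC_right: "cinner x (c *\<^sub>C y) = cnj c * cinner x (y::'a::complex_inner)"
  by (metis cinner_commute cinner_scaleC_left complex_cnj_mult)

lemma cinner_zero_left [simp]: "cinner 0 (y::'a::complex_inner) = 0"
  using cinner_add_left[of 0 0 y] by simp

lemma cinner_scaleR_left: "cinner (r *\<^sub>R x) y = of_real r * cinner x (y::'a::complex_inner)"
  by (metis cinner_scaleC_left scaleC_of_real)

lemma scaleC_minus_one: "(-1) *\<^sub>C x = - (x::'a::complex_inner)"
  using scaleC_of_real[of "-1" x] by simp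

lemma cinner_sum_left: "cinner (\<Sum>i\<in>I. f i) (y::'a::complex_inner) = (\<Sum>i\<in>I. cinner (f i) y)"
  by (induction I rule: infinite_finite_induct) (auto simp: cinner_add_left)

lemma cinner_sum_right: "cinner (y::'a::complex_inner) (\<Sum>i\<in>I. f i) = (\<Sum>i\<in>I. cinner y (f i))"
  by (metis (mono_tags, lifting) cinner_commute cinner_sum_left cnj_sum sum.cong)

lemma norm_add_sq:
  "(norm (x + y))\<^sup>2 = (norm x)\<^sup>2 + (norm y)\<^sup>2 + 2 * Re (cinner x (y::'a::complex_inner))"
proof -
  have "complex_of_real ((norm (x + y))\<^sup>2) = cinner x x + cinner y y + (cinner x y + cnj (cinner x y))"
    by (subst cinner_self[symmetric])
      (simp add: cinner_add_left cinner_add_right cinner_commute[of y x])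
  then have "Re (complex_of_real ((norm (x + y))\<^sup>2)) = Re \<dots>"
    by simp
  then show ?thesis
    by (simp add: cinner_self)
qed

lemma norm_diff_sq:
  "(norm (x - y))\<^sup>2 = (norm x)\<^sup>2 + (norm y)\<^sup>2 - 2 * Re (cinner x (y::'a::complex_inner))"
  using norm_add_sq[of x "(-1) *\<^sub>C y"] cinner_scaleC_right[of x "-1" y]
  by (simp add: scaleC_minus_one)

lemma norm_scaleC: "norm (c *\<^sub>C x) = cmod c * norm (x::'a::complex_inner)"
proof -
  have "complex_of_real ((norm (c *\<^sub>C x))\<^sup>2) = complex_of_real ((cmod c * norm x)\<^sup>2)"
    unfolding cinner_self[symmetric] cinner_scaleC_left cinner_scaleC_right
    by (simp add: power_mult_distrib complex_norm_square[of c] cinner_self mult_ac del: of_real_power)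
  then show ?thesis
    by (metis abs_ge_zero norm_ge_zero of_real_eq_iff power2_eq_iff_nonneg zero_le_mult_iff)
qed

text \<open>The triangle inequality comes with the normed space; squaring it and expanding leaves
  this half of Cauchy-Schwarz.\<close>

lemma Re_cinner_le: "Re (cinner x y) \<le> norm x * norm (y::'a::complex_inner)"
proof -
  have "(norm (x + y))\<^sup>2 \<le> (norm x + norm y)\<^sup>2"
    by (simp add: norm_triangle_ineq power_mono)
  then show ?thesis
    by (simp add: norm_add_sq power2_sum)
qed

lemma cmod_cinner_le: "cmod (cinner x y) \<le> norm x * norm (y::'a::complex_inner)"
proof (cases "cinner x y = 0")
  case False
  \<comment> \<open>A unimodular factor rotating \<open>cinner x y\<close> onto the positive real
    axis, so that the bound on real parts applies to \<open>u *\<^sub>C x\<close>.\<close>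
  define u where "u = cnj (cinner x y) / cmod (cinner x y)"
  have "cmod u = 1"
    using False by (simp add: u_def norm_divide)
  have "u * cinner x y = complex_of_real (cmod (cinner x y))"
    using False complex_norm_square[of "cinner x y"]
    by (simp add: u_def field_simps power2_eq_square)
  then have "cmod (cinner x y) = Re (cinner (u *\<^sub>C x) y)"
    by (simp add: cinner_scaleC_left)
  also have "\<dots> \<le> norm (u *\<^sub>C x) * norm y"
    by (rule Re_cinner_le)
  finally show ?thesis
    using \<open>cmod u = 1\<close> by (simp add: norm_scaleC)
qed auto

lemma bounded_linear_cinner: "bounded_linear (\<lambda>z. cinner z (v::'a::complex_inner))"
  by (rule bounded_linear_intro[of _ "norm v"])
    (auto simp: cinner_add_left cinner_scaleR_left scaleR_conv_of_real cmod_cinner_le)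

text \<open>Polarization: real parts of inner products are determined by norms of sums, and
  imaginary parts are, up to sign, real parts after replacing \<open>x\<close> by
  \<open>\<i> *\<^sub>C x\<close>.\<close>

lemma isometry_cinner:
  assumes "bounded_clinear F" and iso: "\<And>z. norm (F z) = norm z"
  shows "cinner (F x) (F y) = cinner x (y::'a::complex_inner)"
proof -
  have add: "F (u + v) = F u + F v" and sc: "F (c *\<^sub>C u) = c *\<^sub>C F u" for u v c
    using assms(1) by (auto simp: bounded_clinear_def linear_simps)
  have R: "Re (cinner (F u) (F v)) = Re (cinner u v)" for u v
    using norm_add_sq[of "F u" "F v"] norm_add_sq[of u v]
    by (simp add: iso add[symmetric])
  show ?thesis
    using R[of x y] R[of "\<i> *\<^sub>C x" y]
    by (simp add: complex_eq_iff sc cinner_scaleC_left)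
qed

text \<open>\<open>F\<close> maps simple approximants of \<open>f\<close> to simple approximants of
  the composition and enlarges the L1 error at most by the factor \<open>K\<close>. This turns a
  vector integral in a possibly nonseparable space into scalar identities.\<close>

lemma has_bochner_integral_bounded_linear_gen:
  fixes F :: "'b::real_normed_vector \<Rightarrow> 'c::{real_normed_vector, second_countable_topology}"
  assumes F: "bounded_linear F" and f: "has_bochner_integral_gen M f z"
  shows "has_bochner_integral M (\<lambda>t. F (f t)) (F z)"
proof -
  interpret F: bounded_linear F by (rule F)
  obtain s where meas: "f \<in> borel_measurable M"
    and s: "\<And>i. Bochner_Integration.simple_bochner_integrable M (s i)"
    and lim: "(\<lambda>i. \<integral>\<^sup>+t. norm (f t - s i t) \<partial>M) \<longlonglongrightarrow> 0"
    and int: "(\<lambda>i. Bochner_Integration.simple_bochner_integral M (s i)) \<longlonglongrightarrow> z"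
    using f unfolding has_bochner_integral_gen_def by blast
  obtain K where K: "\<And>x. norm (F x) \<le> norm x * K" and "K > 0"
    using F.pos_bounded by blast
  have sF: "Bochner_Integration.simple_bochner_integrable M (\<lambda>t. F (s i t))" for i
    using simple_bochner_integrable_compose2[OF _ s s, of "\<lambda>a b. F a" i i] by (simp add: F.zero)
  show ?thesis
  proof (rule has_bochner_integral.intros[of _ _ "\<lambda>i t. F (s i t)"])
    show "(\<lambda>t. F (f t)) \<in> borel_measurable M"
      by (rule measurable_compose[OF meas borel_measurable_continuous_onI])
        (rule F.continuous_on[OF continuous_on_id])
    show "Bochner_Integration.simple_bochner_integrable M (\<lambda>t. F (s i t))" for i
      by (rule sF)
    show "(\<lambda>i. \<integral>\<^sup>+t. norm (F (f t) - F (s i t)) \<partial>M) \<longlonglongrightarrow> 0"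
    proof (rule tendsto_sandwich[OF _ _ tendsto_const])
      show "\<forall>\<^sub>F i in sequentially.
          (\<integral>\<^sup>+t. norm (F (f t) - F (s i t)) \<partial>M) \<le> ennreal K * (\<integral>\<^sup>+t. norm (f t - s i t) \<partial>M)"
      proof (rule always_eventually, rule allI)
        fix i
        \<comment> \<open>In a nonseparable space a difference of measurable functions need not be
          measurable; as \<open>s i\<close> takes finitely many values, it suffices to treat
          \<open>f\<close> minus a constant.\<close>
        have m: "(\<lambda>t. ennreal (norm (f t - s i t))) \<in> borel_measurable M"
        proof (rule measurable_compose_countable'[where g="s i" and I="s i ` space M"])
          have *: "finite (s i ` space M)" "\<forall>x\<in>space M. s i -` {s i x} \<inter> space M \<in> sets M"
            using s[of i] by (auto simp: simple_bochner_integrable.simps simple_function_def)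
          then show "s i \<in> M \<rightarrow>\<^sub>M count_space (s i ` space M)"
            by (auto simp: measurable_count_space_eq2)
          show "countable (s i ` space M)"
            using * by (simp add: countable_finite)
        qed (intro measurable_compose[OF meas] borel_measurable_continuous_onI continuous_on_ennreal
            continuous_intros)
        have "(\<integral>\<^sup>+t. norm (F (f t) - F (s i t)) \<partial>M) \<le> (\<integral>\<^sup>+t. ennreal K * norm (f t - s i t) \<partial>M)"
          by (intro nn_integral_mono)
            (use K in \<open>auto simp: F.diff[symmetric] ennreal_mult[symmetric] \<open>K > 0\<close> less_imp_le mult.commute\<close>)
        also have "\<dots> = ennreal K * (\<integral>\<^sup>+t. norm (f t - s i t) \<partial>M)"
          by (rule nn_integral_cmult[OF m])
        finally show "(\<integral>\<^sup>+t. norm (F (f t) - F (s i t)) \<partial>M) \<le> \<dots>" .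
      qed
      show "(\<lambda>i. ennreal K * (\<integral>\<^sup>+t. norm (f t - s i t) \<partial>M)) \<longlonglongrightarrow> 0"
        using ennreal_tendsto_cmult[OF _ lim, of "ennreal K"] by simp
    qed simp
    show "(\<lambda>i. Bochner_Integration.simple_bochner_integral M (\<lambda>t. F (s i t))) \<longlonglongrightarrow> F z"
      using F.tendsto[OF int] simple_bochner_integral_linear[OF F.linear s] by simp
  qed
qed

section \<open>Positive definite functions\<close>


lemma sum_cis_roots:
  fixes p :: int
  assumes "\<bar>p\<bar> < 2 * int N"
  shows "(\<Sum>l<2*N. cis (p * (pi * (real l / N - 1)))) = (if p = 0 then of_nat (2 * N) else 0)"
proof (cases "p = 0")
  case False
  have N: "N > 0"
    using assms by auto
  \<comment> \<open>The ratio of the geometric progression: its power \<open>2 * N\<close> is 1, but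
    it is not 1 itself, since \<open>p\<close> is not a multiple of \<open>2 * N\<close>.\<close>
  define r where "r = cis (pi * p / N)"
  have "r \<noteq> 1"
  proof
    assume "r = 1"
    then have "cos (pi * p / N) = 1"
      by (simp add: r_def complex_eq_iff)
    then obtain n :: int where "pi * p / N = n * 2 * pi"
      by (auto simp: cos_one_2pi_int)
    then have "real_of_int p = real_of_int (2 * n * N)"
      using N by (simp add: field_simps)
    then have p: "p = 2 * n * N"
      by linarith
    then have "\<bar>n\<bar> * (2 * int N) < 1 * (2 * int N)"
      using assms by (simp add: abs_mult ac_simps)
    then have "n = 0"
      using N by (simp only: mult_less_cancel_right) auto
    then show False
      using p False by simp
  qed
  have "r ^ (2 * N) = cis (2 * pi * p)"
    using N unfolding r_def Complex.DeMoivre by (intro arg_cong[of _ _ cis]) (simp add: field_simps)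
  then have r1: "r ^ (2 * N) = 1"
    by (simp add: cis_multiple_2pi)
  have "cis (p * (pi * (real l / N - 1))) = cis (- (pi * p)) * r ^ l" for l
    using N unfolding r_def Complex.DeMoivre cis_mult
    by (intro arg_cong[of _ _ cis]) (simp add: field_simps)
  then have "(\<Sum>l<2*N. cis (p * (pi * (real l / N - 1)))) = cis (- (pi * p)) * (\<Sum>l<2*N. r ^ l)"
    by (simp add: sum_distrib_left)
  also have "(\<Sum>l<2*N. r ^ l) = 0"
    using geometric_sum[OF \<open>r \<noteq> 1\<close>, of "2 * N"] r1 by simp
  finally show ?thesis
    using False by simp
qed simp

lemma one_minus_cos_mono:
  assumes "0 \<le> s" "s \<le> h" "\<bar>h * x\<bar> \<le> pi"
  shows "1 - cos (s * x) \<le> 1 - cos (h * (x::real))"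
proof -
  have "cos \<bar>h * x\<bar> \<le> cos \<bar>s * x\<bar>"
    by (rule cos_monotone_0_pi_le) (use assms in \<open>auto simp: abs_mult mult_right_mono\<close>)
  then show ?thesis
    by simp
qed

lemma cmod_cis_minus_one_sq: "(cmod (cis a - 1))\<^sup>2 = 2 * (1 - cos a)"
  unfolding cmod_power2 using sin_cos_squared_add[of a] by (simp add: power2_eq_square algebra_simps)

text \<open>Weighted Cauchy-Schwarz together with |cis a - 1|^2 = 2 (1 - cos a). The frequency bound
  keeps \<open>h * \<xi> l\<close> where the cosine is monotone, so one value at time
  \<open>h\<close> controls the oscillation over all shorter times.\<close>

lemma sum_weights_cis_minus_one_le:
  fixes w \<xi> :: "nat \<Rightarrow> real"
  assumes w: "\<And>l. l < L \<Longrightarrow> 0 \<le> w l" and "0 \<le> s" "s \<le> h"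
    and \<xi>: "\<And>l. l < L \<Longrightarrow> \<bar>h * \<xi> l\<bar> \<le> pi"
  shows "(\<Sum>l<L. w l * cmod (cis (s * \<xi> l) - 1))
    \<le> sqrt ((\<Sum>l<L. w l) * (2 * (\<Sum>l<L. w l * (1 - cos (h * \<xi> l)))))"
proof (rule real_le_rsqrt)
  have "(\<Sum>l<L. w l * cmod (cis (s * \<xi> l) - 1))\<^sup>2
      = (\<Sum>l<L. sqrt (w l) * (sqrt (w l) * cmod (cis (s * \<xi> l) - 1)))\<^sup>2"
    using w by (simp add: mult.assoc[symmetric])
  also have "\<dots> \<le> (\<Sum>l<L. (sqrt (w l))\<^sup>2) * (\<Sum>l<L. (sqrt (w l) * cmod (cis (s * \<xi> l) - 1))\<^sup>2)"
    by (rule Cauchy_Schwarz_ineq_sum)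
  also have "\<dots> = (\<Sum>l<L. w l) * (\<Sum>l<L. w l * (2 * (1 - cos (s * \<xi> l))))"
    using w by (simp add: power_mult_distrib cmod_cis_minus_one_sq)
  also have "\<dots> \<le> (\<Sum>l<L. w l) * (\<Sum>l<L. w l * (2 * (1 - cos (h * \<xi> l))))"
    by (intro mult_left_mono sum_mono sum_nonneg one_minus_cos_mono) (use assms in auto)
  finally show "(\<Sum>l<L. w l * cmod (cis (s * \<xi> l) - 1))\<^sup>2
    \<le> (\<Sum>l<L. w l) * (2 * (\<Sum>l<L. w l * (1 - cos (h * \<xi> l))))"
    by (simp add: sum_distrib_left mult_ac)
qed

text \<open>The Hermitian condition makes the double sum real, so the clause with \<open>Re\<close>
  is the usual positive semidefiniteness of the matrices with entries
  \<open>\<rho> (t j - t k)\<close>.\<close>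

definition positive_definite :: "(real \<Rightarrow> complex) \<Rightarrow> bool" where
  "positive_definite \<rho> \<longleftrightarrow> (\<forall>t. \<rho> (- t) = cnj (\<rho> t)) \<and>
     (\<forall>N (t::nat \<Rightarrow> real) c. 0 \<le> Re (\<Sum>j<N. \<Sum>k<N. c j * cnj (c k) * \<rho> (t j - t k)))"

text \<open>The diagonal \<open>j - k = m\<close> contains \<open>N - m\<close> index pairs; this
  count is the source of the Fejer factor 1 - m/N.\<close>

lemma sum_diagonal:
  fixes f :: "int \<Rightarrow> complex"
  assumes "m < N"
  shows "(\<Sum>j<N. \<Sum>k<N. f (int j - int k) * (if int m - (int j - int k) = 0 then c else 0))
    = of_nat (N - m) * (f m * c)"
proof -
  have "(\<Sum>j<N. \<Sum>k<N. f (int j - int k) * (if int m - (int j - int k) = 0 then c else 0))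
      = (\<Sum>k<N. \<Sum>j<N. if j = k + m then f m * c else 0)"
    by (subst sum.swap) (intro sum.cong, auto)
  also have "\<dots> = (\<Sum>k<N. if k + m < N then f m * c else 0)"
    by (simp add: sum.delta)
  also have "\<dots> = (\<Sum>k | k < N \<and> k + m < N. f m * c)"
    by (simp add: sum.inter_filter[symmetric] Collect_conj_eq lessThan_def)
  also have "{k. k < N \<and> k + m < N} = {..<N - m}"
    by auto
  finally show ?thesis
    by simp
qed

text \<open>Fejer means: the quadratic form of the samples is evaluated at the characters belonging
  to 2N equispaced angles. Its values are nonnegative and serve as weights, and orthogonality of the
  characters recovers the samples up to the Fejer factor.\<close>

lemma positive_definite_quadrature:
  assumes pd: "positive_definite \<rho>" and "1 < N" "0 < h"
  obtains w \<xi> :: "nat \<Rightarrow> real" where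
    "\<And>l. 0 \<le> w l"
    "\<And>l. l < 2 * N \<Longrightarrow> \<bar>h * \<xi> l\<bar> \<le> pi"
    "\<And>m. m < N \<Longrightarrow> (\<Sum>l<2*N. w l * cis (real m * h * \<xi> l))
      = (1 - of_real (m / N)) * \<rho> (m * h)"
proof -
  define \<theta> where "\<theta> = (\<lambda>l. pi * (real l / N - 1))"
  define S where "S = (\<lambda>l. \<Sum>j<N. \<Sum>k<N. cis (- (j * \<theta> l)) * cnj (cis (- (k * \<theta> l))) * \<rho> (j * h - k * h))"
  \<comment> \<open>The factor \<open>2 * N\<close> normalizes the sum over the nodes, the factor
    \<open>N\<close> the count of pairs on the main diagonal.\<close>
  define w where "w = (\<lambda>l. Re (S l) / (2 * N * N))"
  have h1: "\<rho> (- t) = cnj (\<rho> t)" for t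
    using pd by (simp add: positive_definite_def)
  have h2: "0 \<le> Re (S l)" for l
    using pd[unfolded positive_definite_def, THEN conjunct2, rule_format,
      of "\<lambda>j. cis (- (j * \<theta> l))" "\<lambda>j. j * h" N]
    unfolding S_def by simp
  \<comment> \<open>Conjugation exchanges the roles of \<open>j\<close> and
    \<open>k\<close>.\<close>
  have "cnj (S l) = S l" for l
  proof -
    have "cnj (S l) = (\<Sum>j<N. \<Sum>k<N. cis (- (k * \<theta> l)) * cnj (cis (- (j * \<theta> l))) * \<rho> (k * h - j * h))"
      unfolding S_def cnj_sum
      by (intro sum.cong refl) (simp add: h1[symmetric] del: cis_cnj)
    then show ?thesis
      unfolding S_def by (subst sum.swap)
  qed
  then have S: "complex_of_real (Re (S l)) = S l" for l
    by (simp add: complex_eq_iff)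
  have "(\<Sum>l<2*N. w l * cis (m * h * (\<theta> l / h))) = (1 - of_real (m / N)) * \<rho> (m * h)" if m: "m < N" for m
  proof -
    have "S l * cis (m * \<theta> l)
        = (\<Sum>j<N. \<Sum>k<N. \<rho> ((int j - int k) * h) * cis ((int m - (int j - int k)) * \<theta> l))" for l
      unfolding S_def sum_distrib_right
      by (intro sum.cong refl) (simp add: cis_cnj cis_mult algebra_simps)
    then have "(\<Sum>l<2*N. S l * cis (m * \<theta> l))
        = (\<Sum>l<2*N. \<Sum>j<N. \<Sum>k<N. \<rho> ((int j - int k) * h) * cis ((int m - (int j - int k)) * \<theta> l))"
      by simp
    also have "\<dots> = (\<Sum>j<N. \<Sum>k<N. \<rho> ((int j - int k) * h) * (\<Sum>l<2*N. cis ((int m - (int j - int k)) * \<theta> l)))"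
      unfolding sum_distrib_left by (rule trans[OF sum.swap], rule sum.cong[OF refl], rule sum.swap)
    \<comment> \<open>Here \<open>m - (j - k)\<close> ranges strictly between -2N and 2N; this is
      why 2N nodes are taken rather than N.\<close>
    also have "\<dots> = (\<Sum>j<N. \<Sum>k<N. \<rho> ((int j - int k) * h) * (if int m - (int j - int k) = 0 then of_nat (2 * N) else 0))"
      unfolding \<theta>_def using m by (intro sum.cong refl arg_cong2[where f="(*)"] sum_cis_roots) auto
    also have "\<dots> = of_nat (N - m) * (\<rho> (m * h) * of_nat (2 * N))"
      using sum_diagonal[OF m, of "\<lambda>p. \<rho> (p * h)"] by simp
    finally have *: "(\<Sum>l<2*N. S l * cis (m * \<theta> l)) = of_nat (N - m) * (\<rho> (m * h) * of_nat (2 * N))" .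
    have "(\<Sum>l<2*N. w l * cis (m * h * (\<theta> l / h))) = (\<Sum>l<2*N. S l * cis (m * \<theta> l)) / (2 * N * N)"
      using \<open>0 < h\<close> by (simp add: w_def S sum_divide_distrib)
    also have "\<dots> = (1 - of_real (m / N)) * \<rho> (m * h)"
      unfolding * using m by (simp add: field_simps of_nat_diff)
    finally show ?thesis .
  qed
  moreover have "\<bar>h * (\<theta> l / h)\<bar> \<le> pi" if "l < 2 * N" for l
  proof -
    have "\<bar>real l / N - 1\<bar> \<le> 1"
      using that \<open>1 < N\<close> by (auto simp: abs_le_iff field_simps)
    then have "pi * \<bar>real l / N - 1\<bar> \<le> pi * 1"
      by (intro mult_left_mono) auto
    then show ?thesis
      using \<open>0 < h\<close> by (simp add: \<theta>_def abs_mult)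
  qed
  moreover have "0 \<le> w l" for l
    using h2[of l] by (simp add: w_def)
  ultimately show ?thesis
    using that[of w "\<lambda>l. \<theta> l / h"] by blast
qed

text \<open>The grid has mesh 1/(n + 2) and (n + 2)^2 points: the mesh shrinks while the covered
  range grows without bound, and at a fixed time the Fejer factor tends to 1.\<close>

lemma floor_grid_tendsto:
  fixes t :: real
  assumes "0 \<le> t"
  defines "m \<equiv> (\<lambda>n. nat \<lfloor>t * (real n + 2)\<rfloor>)"
  shows "(\<lambda>n. m n * (1 / (real n + 2))) \<longlonglongrightarrow> t"
    and "(\<lambda>n. m n / (real n + 2)\<^sup>2) \<longlonglongrightarrow> 0"
    and "\<forall>\<^sub>F n in sequentially. m n < (n + 2)\<^sup>2"
    and "m n * (1 / (real n + 2)) \<le> t" and "t \<le> m n * (1 / (real n + 2)) + 1 / (real n + 2)"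
proof -
  have b: "m n \<le> t * (real n + 2)" "t * (real n + 2) \<le> m n + 1" for n
    using assms(1) by (auto simp: m_def) linarith
  show c: "m n * (1 / (real n + 2)) \<le> t" "t \<le> m n * (1 / (real n + 2)) + 1 / (real n + 2)" for n
    using b[of n] by (auto simp: field_simps)
  have z: "(\<lambda>n. 1 / (real n + 2)) \<longlonglongrightarrow> 0"
    by real_asymp
  show *: "(\<lambda>n. m n * (1 / (real n + 2))) \<longlonglongrightarrow> t"
  proof (rule tendsto_sandwich)
    show "(\<lambda>n. t - 1 / (real n + 2)) \<longlonglongrightarrow> t"
      using tendsto_diff[OF tendsto_const z, of t] by simp
    show "\<forall>\<^sub>F n in sequentially. t - 1 / (real n + 2) \<le> m n * (1 / (real n + 2))"
      using c by (auto simp: diff_le_eq)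
    show "\<forall>\<^sub>F n in sequentially. m n * (1 / (real n + 2)) \<le> t"
      using c by auto
  qed simp
  show "(\<lambda>n. m n / (real n + 2)\<^sup>2) \<longlonglongrightarrow> 0"
    using tendsto_mult[OF * z] by (simp add: power2_eq_square)
  have "\<forall>\<^sub>F n in sequentially. t < real n + 2"
    by real_asymp
  then show "\<forall>\<^sub>F n in sequentially. m n < (n + 2)\<^sup>2"
  proof eventually_elim
    case (elim n)
    have "real (m n) < (real n + 2) * (real n + 2)"
      using b(1)[of n] mult_strict_right_mono[OF elim, of "real n + 2"] by linarith
    also have "\<dots> = real ((n + 2)\<^sup>2)"
      by (simp add: power2_eq_square algebra_simps)
    finally show ?case
      using of_nat_less_iff by blast
  qed
qed

text \<open>On the grid the quadrature reproduces \<open>\<rho>\<close> up to the Fejer factor. Off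
  the grid the error is governed by the deficit \<open>\<rho> 0 - \<phi> n (h n)\<close>, which
  vanishes by continuity of \<open>\<rho>\<close> at 0.\<close>

lemma positive_definite_approx:
  assumes pd: "positive_definite \<rho>" and cont: "continuous_on UNIV \<rho>"
  obtains w \<xi> :: "nat \<Rightarrow> nat \<Rightarrow> real" and L :: "nat \<Rightarrow> nat" where
    "\<And>n l. 0 \<le> w n l" "\<And>n. (\<Sum>l<L n. complex_of_real (w n l)) = \<rho> 0"
    "\<And>t. (\<lambda>n. \<Sum>l<L n. w n l * cis (t * \<xi> n l)) \<longlonglongrightarrow> \<rho> t"
proof -
  define N where "N = (\<lambda>n::nat. (n + 2)\<^sup>2)"
  define h where "h = (\<lambda>n::nat. 1 / (real n + 2))"
  have N1: "1 < N n" for n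
    by (simp add: N_def power2_eq_square)
  have h0: "0 < h n" for n
    by (simp add: h_def)
  have h_lim: "h \<longlonglongrightarrow> 0"
    unfolding h_def by real_asymp
  have "(\<lambda>n. 1 / (real n + 2)\<^sup>2) \<longlonglongrightarrow> 0"
    by real_asymp
  then have N_lim: "(\<lambda>n. 1 / real (N n)) \<longlonglongrightarrow> 0"
    by (simp add: N_def add.commute)
  define Q where "Q = (\<lambda>n w \<xi>. (\<forall>l. 0 \<le> w l) \<and> (\<forall>l<2 * N n. \<bar>h n * \<xi> l\<bar> \<le> pi) \<and>
     (\<forall>m<N n. (\<Sum>l<2*N n. complex_of_real (w l) * cis (real m * h n * \<xi> l))
        = (1 - of_real (real m / N n)) * \<rho> (m * h n)))"
  have "\<exists>w \<xi>. Q n w \<xi>" for n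
    by (rule positive_definite_quadrature[OF pd N1[of n] h0[of n]]) (auto simp: Q_def)
  then obtain w \<xi> where Q: "\<And>n. Q n (w n) (\<xi> n)"
    by metis
  then have w: "0 \<le> w n l" and \<xi>: "l < 2 * N n \<Longrightarrow> \<bar>h n * \<xi> n l\<bar> \<le> pi"
    and q: "m < N n \<Longrightarrow> (\<Sum>l<2*N n. complex_of_real (w n l) * cis (real m * h n * \<xi> n l))
      = (1 - of_real (real m / N n)) * \<rho> (m * h n)" for n l m
    by (simp_all add: Q_def)
  define \<phi> where "\<phi> = (\<lambda>n t. \<Sum>l<2*N n. complex_of_real (w n l) * cis (t * \<xi> n l))"
  have tot: "(\<Sum>l<2*N n. complex_of_real (w n l)) = \<rho> 0" for n
    using q[of 0 n] N1[of n] by simp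
  have q1: "\<phi> n (h n) = (1 - of_real (1 / N n)) * \<rho> (h n)" for n
    using q[of 1 n] N1[of n] by (simp add: \<phi>_def)
  \<comment> \<open>The bound of \<open>sum_weights_cis_minus_one_le\<close> with the total mass and
    the known value at time \<open>h n\<close> inserted. That value is the grid point
    \<open>m = 1\<close>, hence the need for \<open>1 < N n\<close>.\<close>
  define E where "E = (\<lambda>n. sqrt (Re (\<rho> 0) * (2 * Re (\<rho> 0 - (1 - complex_of_real (1 / N n)) * \<rho> (h n)))))"
  have lim_comp: "(\<lambda>n. \<rho> (f n)) \<longlonglongrightarrow> \<rho> t" if "f \<longlonglongrightarrow> t" for f :: "nat \<Rightarrow> real" and t
    using continuous_on_tendsto_compose[OF cont that] by simp
  have "E \<longlonglongrightarrow> sqrt (Re (\<rho> 0) * (2 * Re (\<rho> 0 - (1 - complex_of_real 0) * \<rho> 0)))"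
    unfolding E_def
    by (intro tendsto_intros lim_comp h_lim) (rule N_lim)
  then have E: "E \<longlonglongrightarrow> 0"
    by simp
  have near: "cmod (\<phi> n t - \<phi> n s) \<le> E n" if "s \<le> t" "t \<le> s + h n" for n s t
  proof -
    have "\<phi> n t - \<phi> n s = (\<Sum>l<2*N n. w n l * cis (s * \<xi> n l) * (cis ((t - s) * \<xi> n l) - 1))"
      by (simp add: \<phi>_def sum_subtractf[symmetric] algebra_simps cis_mult)
    also have "cmod \<dots> \<le> (\<Sum>l<2*N n. w n l * cmod (cis ((t - s) * \<xi> n l) - 1))"
      by (rule norm_sum[THEN order_trans]) (simp add: norm_mult w)
    also have "\<dots> \<le> sqrt ((\<Sum>l<2*N n. w n l) * (2 * (\<Sum>l<2*N n. w n l * (1 - cos (h n * \<xi> n l)))))"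
      by (rule sum_weights_cis_minus_one_le) (use w \<xi> that in auto)
    also have "(\<Sum>l<2*N n. w n l) = Re (\<rho> 0)"
      by (simp flip: tot[of n])
    also have "(\<Sum>l<2*N n. w n l * (1 - cos (h n * \<xi> n l))) = Re (\<rho> 0 - \<phi> n (h n))"
      by (simp add: \<phi>_def sum_subtractf algebra_simps flip: tot[of n])
    also have "sqrt (Re (\<rho> 0) * (2 * Re (\<rho> 0 - \<phi> n (h n)))) = E n"
      by (simp only: E_def q1)
    finally show ?thesis .
  qed
  have nonneg: "(\<lambda>n. \<phi> n t) \<longlonglongrightarrow> \<rho> t" if "0 \<le> t" for t
  proof -
    define m where "m = (\<lambda>n::nat. nat \<lfloor>t * (real n + 2)\<rfloor>)"
    note grid = floor_grid_tendsto[OF that]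
    \<comment> \<open>Compare \<open>t\<close> with the nearest grid point to its left, at distance
      at most \<open>h n\<close>.\<close>
    have "(\<lambda>n. \<phi> n t - \<phi> n (m n * h n)) \<longlonglongrightarrow> 0"
      by (rule Lim_null_comparison[OF always_eventually E])
        (use near grid(4,5) in \<open>auto simp: h_def m_def\<close>)
    moreover have "(\<lambda>n. \<phi> n (m n * h n)) \<longlonglongrightarrow> \<rho> t"
    proof (rule Lim_transform_eventually)
      have "(\<lambda>n. (1 - complex_of_real (m n / N n)) * \<rho> (m n * h n)) \<longlonglongrightarrow> (1 - complex_of_real 0) * \<rho> t"
        by (intro tendsto_intros lim_comp)
          (use grid(1,2) in \<open>simp_all add: h_def N_def m_def add.commute\<close>)
      then show "(\<lambda>n. (1 - complex_of_real (m n / N n)) * \<rho> (m n * h n)) \<longlonglongrightarrow> \<rho> t"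
        by simp
      have "\<forall>\<^sub>F n in sequentially. m n < N n"
        using grid(3) by (simp add: N_def m_def)
      then show "\<forall>\<^sub>F n in sequentially. (1 - complex_of_real (m n / N n)) * \<rho> (m n * h n) = \<phi> n (m n * h n)"
        by eventually_elim (simp only: \<phi>_def q)
    qed
    ultimately show ?thesis
      using tendsto_add by fastforce
  qed
  have "(\<lambda>n. \<phi> n t) \<longlonglongrightarrow> \<rho> t" for t
  proof (cases "0 \<le> t")
    case False
    have "cnj (\<phi> n (- t)) = \<phi> n t" for n
      by (simp add: \<phi>_def cis_cnj)
    moreover have "cnj (\<rho> (- t)) = \<rho> t"
      using pd by (simp add: positive_definite_def)
    ultimately show ?thesis
      using tendsto_cnj[OF nonneg[of "- t"]] False by simp
  qed (rule nonneg)
  then show ?thesis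
    using that[of w "\<lambda>n. 2 * N n" \<xi>] w tot by (simp add: \<phi>_def)
qed

section \<open>Spectral localization\<close>


lemma fourier_eq_cis: "fourier f \<xi> = (LINT t|lborel. f t * cis (- (t * \<xi>)))"
  by (simp add: fourier_def cis_conv_exp)

lemma integrable_mult_bounded:
  fixes f g :: "real \<Rightarrow> complex"
  assumes "integrable lborel f" "g \<in> borel_measurable borel" "\<And>t. cmod (g t) \<le> c"
  shows "integrable lborel (\<lambda>t. f t * g t)"
proof (rule Bochner_Integration.integrable_bound)
  show "integrable lborel (\<lambda>t. c * cmod (f t))"
    using assms(1) by simp
  show "AE t in lborel. norm (f t * g t) \<le> norm (c * cmod (f t))"
  proof (intro AE_I2)
    fix t
    have "0 \<le> c"
      using assms(3)[of t] norm_ge_zero order_trans by blast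
    then show "norm (f t * g t) \<le> norm (c * cmod (f t))"
      using mult_right_mono[OF assms(3)[of t], of "cmod (f t)"] by (simp add: norm_mult ac_simps)
  qed
  show "(\<lambda>t. f t * g t) \<in> borel_measurable lborel"
    using borel_measurable_integrable[OF assms(1)] assms(2) by simp
qed

lemma cis_measurable [measurable]: "cis \<in> borel_measurable borel"
  by (intro borel_measurable_continuous_onI continuous_intros)

lemma integrable_mult_cis:
  "integrable lborel f \<Longrightarrow> integrable lborel (\<lambda>t. f t * cis (a * t + b))"
  by (rule integrable_mult_bounded[where c=1]) simp_all

text \<open>Dominated convergence with majorant |f|. Continuity provides the open cover used in
  \<open>compact_mass\<close>.\<close>

lemma continuous_on_fourier:
  assumes f: "integrable lborel f"
  shows "continuous_on UNIV (fourier f)"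
proof (rule continuous_at_imp_continuous_on, intro ballI)
  fix \<mu>
  show "isCont (fourier f) \<mu>"
    unfolding continuous_at_sequentially
  proof (intro allI impI)
    fix x :: "nat \<Rightarrow> real"
    assume x: "x \<longlonglongrightarrow> \<mu>"
    show "(fourier f \<circ> x) \<longlonglongrightarrow> fourier f \<mu>"
      unfolding comp_def fourier_eq_cis
    proof (rule integral_dominated_convergence[where w="\<lambda>t. cmod (f t)"])
      have "(\<lambda>i. f t * cis (- (t * x i))) \<longlonglongrightarrow> f t * cis (- (t * \<mu>))" for t
        by (intro tendsto_intros x isCont_tendsto_compose[of _ cis] continuous_on_cis)
      then show "AE t in lborel. (\<lambda>i. f t * cis (- (t * x i))) \<longlonglongrightarrow> f t * cis (- (t * \<mu>))"
        by simp
    qed (use f borel_measurable_integrable[OF f] in \<open>auto simp: norm_mult\<close>)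
  qed
qed

text \<open>The \<open>n\<close>-th measure has mass \<open>w n l\<close> at the frequency
  \<open>\<xi> n l\<close>. All these measures have total mass \<open>\<rho> 0\<close>, and their
  Fourier transforms converge pointwise to \<open>\<rho>\<close>, so they stand in for its spectral
  measure.\<close>

locale quadrature =
  fixes w \<xi> :: "nat \<Rightarrow> nat \<Rightarrow> real" and L :: "nat \<Rightarrow> nat" and \<rho> :: "real \<Rightarrow> complex"
  assumes weight_nonneg: "0 \<le> w n l"
    and total: "(\<Sum>l<L n. complex_of_real (w n l)) = \<rho> 0"
    and lim: "(\<lambda>n. \<Sum>l<L n. w n l * cis (t * \<xi> n l)) \<longlonglongrightarrow> \<rho> t"
    and cont: "continuous_on UNIV \<rho>"
begin

lemma total_real: "(\<Sum>l<L n. w n l) = Re (\<rho> 0)"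
  by (simp flip: total[of n])

text \<open>Exchanging the finite sum with the integral gives the convolution of \<open>f\<close>
  with the \<open>n\<close>-th transform, which is bounded by \<open>Re (\<rho> 0)\<close>;
  dominated convergence applies. The second bound is uniform in \<open>n\<close> and
  \<open>s\<close> and serves as a majorant later.\<close>

lemma lim_fourier:
  assumes f: "integrable lborel f"
  shows "(\<lambda>n. \<Sum>l<L n. w n l * fourier f (\<xi> n l) * cis (s * \<xi> n l)) \<longlonglongrightarrow> (LINT t|lborel. f t * \<rho> (s - t))"
    and "cmod (\<Sum>l<L n. w n l * fourier f (\<xi> n l) * cis (s * \<xi> n l)) \<le> Re (\<rho> 0) * (LINT t|lborel. cmod (f t))"
proof -
  define \<phi> where "\<phi> = (\<lambda>n t. \<Sum>l<L n. complex_of_real (w n l) * cis (t * \<xi> n l))"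
  have meas: "(\<lambda>t. \<phi> n (s - t)) \<in> borel_measurable borel" for n
    unfolding \<phi>_def by measurable
  have bound: "cmod (\<phi> n t) \<le> Re (\<rho> 0)" for n t
    unfolding \<phi>_def total_real[of n, symmetric]
    by (rule norm_sum[THEN order_trans]) (simp add: norm_mult weight_nonneg)
  have bound': "cmod (f t * \<phi> n u) \<le> Re (\<rho> 0) * cmod (f t)" for n t u
    using mult_right_mono[OF bound norm_ge_zero, of n u "f t"] by (simp add: norm_mult mult.commute)
  have eq: "(\<Sum>l<L n. w n l * fourier f (\<xi> n l) * cis (s * \<xi> n l)) = (LINT t|lborel. f t * \<phi> n (s - t))" for n
  proof -
    have "(LINT t|lborel. f t * \<phi> n (s - t))
        = (LINT t|lborel. (\<Sum>l<L n. w n l * cis (s * \<xi> n l) * (f t * cis (- (t * \<xi> n l)))))"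
      unfolding \<phi>_def sum_distrib_left
      by (intro Bochner_Integration.integral_cong sum.cong refl) (simp add: cis_mult algebra_simps)
    also have "\<dots> = (\<Sum>l<L n. w n l * cis (s * \<xi> n l) * fourier f (\<xi> n l))"
      unfolding fourier_eq_cis
      by (subst Bochner_Integration.integral_sum)
        (use integrable_mult_cis[OF f, of "- \<xi> n _" 0] in \<open>auto simp: mult.commute\<close>)
    finally show ?thesis
      by (simp add: mult_ac)
  qed
  show "(\<lambda>n. \<Sum>l<L n. w n l * fourier f (\<xi> n l) * cis (s * \<xi> n l)) \<longlonglongrightarrow> (LINT t|lborel. f t * \<rho> (s - t))"
    unfolding eq
  proof (rule integral_dominated_convergence[where w="\<lambda>t. Re (\<rho> 0) * cmod (f t)"])
    have "\<rho> \<in> borel_measurable borel"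
      by (rule borel_measurable_continuous_onI[OF cont])
    then show "(\<lambda>t. f t * \<rho> (s - t)) \<in> borel_measurable lborel"
      using borel_measurable_integrable[OF f] by simp
    show "(\<lambda>t. f t * \<phi> n (s - t)) \<in> borel_measurable lborel" for n
      using borel_measurable_integrable[OF f] meas[of n] by simp
    show "AE t in lborel. (\<lambda>n. f t * \<phi> n (s - t)) \<longlonglongrightarrow> f t * \<rho> (s - t)"
      unfolding \<phi>_def by (intro AE_I2 tendsto_intros lim)
    show "AE t in lborel. norm (f t * \<phi> n (s - t)) \<le> Re (\<rho> 0) * cmod (f t)" for n
      using bound' by simp
  qed (use f in simp)
  show "cmod (\<Sum>l<L n. w n l * fourier f (\<xi> n l) * cis (s * \<xi> n l)) \<le> Re (\<rho> 0) * (LINT t|lborel. cmod (f t))"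
  proof -
    have "cmod (LINT t|lborel. f t * \<phi> n (s - t)) \<le> (LINT t|lborel. Re (\<rho> 0) * cmod (f t))"
      using integrable_mult_bounded[OF f meas bound] f
      by (intro order_trans[OF integral_norm_bound] integral_mono bound') auto
    then show ?thesis
      by (simp add: eq)
  qed
qed

text \<open>Integrating \<open>g n\<close> against the conjugate of \<open>f\<close> yields exactly
  the integral of the squared modulus of \<open>fourier f\<close> over the \<open>n\<close>-th
  measure. Since \<open>g n\<close> tends pointwise to the convolution, which is 0, and is uniformly
  bounded, this energy vanishes in the limit.\<close>

lemma annihilator_energy:
  assumes f: "integrable lborel f" and ann: "\<And>s. (LINT t|lborel. f t * \<rho> (s - t)) = 0"
  shows "(\<lambda>n. \<Sum>l<L n. w n l * (cmod (fourier f (\<xi> n l)))\<^sup>2) \<longlonglongrightarrow> 0"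
proof -
  define g where "g = (\<lambda>n s. \<Sum>l<L n. w n l * fourier f (\<xi> n l) * cis (s * \<xi> n l))"
  have cf: "integrable lborel (\<lambda>s. cnj (f s))"
    using f by simp
  have "(LINT s|lborel. cnj (f s) * g n s) = (\<Sum>l<L n. w n l * (cmod (fourier f (\<xi> n l)))\<^sup>2)" for n
  proof -
    have F: "(LINT s|lborel. cnj (f s) * cis (s * x)) = cnj (fourier f x)" for x
      using Bochner_Integration.integral_cnj[of lborel "\<lambda>t. f t * cis (- (t * x))"] by (simp add: fourier_eq_cis cis_cnj)
    have "(LINT s|lborel. cnj (f s) * g n s)
        = (LINT s|lborel. (\<Sum>l<L n. w n l * fourier f (\<xi> n l) * (cnj (f s) * cis (s * \<xi> n l))))"
      unfolding g_def sum_distrib_left by (simp add: mult_ac)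
    also have "\<dots> = (\<Sum>l<L n. w n l * fourier f (\<xi> n l) * cnj (fourier f (\<xi> n l)))"
      by (subst Bochner_Integration.integral_sum)
        (use integrable_mult_cis[OF cf, of "\<xi> n _" 0] in \<open>auto simp: mult.commute[of "\<xi> n _"] F\<close>)
    finally show ?thesis
      by (simp add: complex_norm_square mult.assoc del: of_real_power)
  qed
  moreover have "(\<lambda>n. LINT s|lborel. cnj (f s) * g n s) \<longlonglongrightarrow> (LINT s|lborel. cnj (f s) * 0)"
  proof (rule integral_dominated_convergence[where w="\<lambda>s. Re (\<rho> 0) * (LINT t|lborel. cmod (f t)) * cmod (f s)"])
    show "(\<lambda>s. cnj (f s) * g n s) \<in> borel_measurable lborel" for n
      using borel_measurable_integrable[OF cf] unfolding g_def by measurable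
    have "(\<lambda>n. cnj (f s) * g n s) \<longlonglongrightarrow> cnj (f s) * 0" for s
      unfolding g_def using lim_fourier(1)[OF f, of s] by (intro tendsto_intros) (simp add: ann)
    then show "AE s in lborel. (\<lambda>n. cnj (f s) * g n s) \<longlonglongrightarrow> cnj (f s) * 0"
      by simp
    show "AE s in lborel. norm (cnj (f s) * g n s) \<le> Re (\<rho> 0) * (LINT t|lborel. cmod (f t)) * cmod (f s)" for n
      using mult_right_mono[OF lim_fourier(2)[OF f, of n] norm_ge_zero] unfolding g_def
      by (intro AE_I2) (simp add: norm_mult mult.commute)
  qed (use f in simp_all)
  ultimately have "(\<lambda>n. complex_of_real (\<Sum>l<L n. w n l * (cmod (fourier f (\<xi> n l)))\<^sup>2)) \<longlonglongrightarrow> of_real 0"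
    by simp
  then show ?thesis
    by (simp only: tendsto_of_real_iff)
qed

end

section \<open>Tightness and localization of the approximating measures\<close>

lemma fourier_indicator:
  assumes "0 < \<eta>" "x \<noteq> 0"
  shows "fourier (\<lambda>t. of_real (indicator {0..\<eta>} t / \<eta>)) x = (1 - cis (- (\<eta> * x))) / (\<i> * (\<eta> * x))"
proof -
  define F where "F = (\<lambda>t. - cis (- (t * x)) / (\<i> * (\<eta> * x)))"
  have "(LINT t|lborel. indicator {0..\<eta>} t *\<^sub>R (cis (- (t * x)) / \<eta>)) = F \<eta> - F 0"
  proof (rule integral_FTC_Icc)
    have "((\<lambda>z. - exp (- (\<i> * (z * x))) / (\<i> * (\<eta> * x))) has_field_derivative
        exp (- (\<i> * (z * x))) / \<eta>) (at z)" for z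
      by (rule derivative_eq_intros refl)+ (use assms in \<open>auto simp: field_simps\<close>)
    from has_vector_derivative_real_field[OF this]
    show "(F has_vector_derivative cis (- (t * x)) / \<eta>) (at t within {0..\<eta>})" for t
      by (simp add: F_def cis_conv_exp)
    show "continuous_on {0..\<eta>} (\<lambda>t. cis (- (t * x)) / complex_of_real \<eta>)"
      using assms by (intro continuous_intros) auto
  qed (use assms in simp)
  moreover have "fourier (\<lambda>t. of_real (indicator {0..\<eta>} t / \<eta>)) x
      = (LINT t|lborel. indicator {0..\<eta>} t *\<^sub>R (cis (- (t * x)) / \<eta>))"
    unfolding fourier_eq_cis
    by (intro Bochner_Integration.integral_cong) (auto simp: scaleR_conv_of_real)
  ultimately show ?thesis
    by (simp add: F_def diff_divide_distrib)
qed

text \<open>The closed form has modulus at most 2/(\<eta> |x|), hence the threshold 4/\<eta> for the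
  value 1/2; the second bound is the L1 norm of the normalized indicator.\<close>

lemma fourier_indicator_le:
  assumes "0 < \<eta>"
  shows "\<bar>x\<bar> > 4 / \<eta> \<Longrightarrow> cmod (fourier (\<lambda>t. of_real (indicator {0..\<eta>} t / \<eta>)) x) \<le> 1 / 2"
    and "cmod (fourier (\<lambda>t. of_real (indicator {0..\<eta>} t / \<eta>)) x) \<le> 1"
proof -
  show "cmod (fourier (\<lambda>t. of_real (indicator {0..\<eta>} t / \<eta>)) x) \<le> 1 / 2" if "\<bar>x\<bar> > 4 / \<eta>"
  proof -
    have x: "x \<noteq> 0" "4 < \<eta> * \<bar>x\<bar>"
      using that assms by (auto simp: field_simps)
    have "cmod (1 - cis (- (\<eta> * x))) \<le> 2"
      using norm_triangle_ineq4[of 1 "cis (- (\<eta> * x))"] by simp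
    then show ?thesis
      unfolding fourier_indicator[OF assms x(1)]
      using x assms by (simp add: norm_divide norm_mult abs_mult field_simps)
  qed
  have "cmod (fourier (\<lambda>t. of_real (indicator {0..\<eta>} t / \<eta>)) x)
      \<le> (LINT t|lborel. cmod (of_real (indicator {0..\<eta>} t / \<eta>) * cis (- (t * x))))"
    unfolding fourier_eq_cis by (rule integral_norm_bound)
  also have "\<dots> = (LINT t|lborel. indicator {0..\<eta>} t / \<eta>)"
    using assms by (intro Bochner_Integration.integral_cong) (auto simp: norm_mult norm_divide indicator_def)
  also have "\<dots> = 1"
    using assms by simp
  finally show "cmod (fourier (\<lambda>t. of_real (indicator {0..\<eta>} t / \<eta>)) x) \<le> 1" .
qed

context quadrature
begin

text \<open>The truncation argument of Levy's continuity theorem: the mean of \<open>\<rho>\<close>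
  over a short interval next to 0 is close to \<open>\<rho> 0\<close>, whereas averaging at least
  halves the contribution of every frequency beyond 4/\<eta>. Twice the loss therefore bounds the
  tail.\<close>

lemma tail_mass:
  assumes "0 < e"
  obtains R where "\<forall>\<^sub>F n in sequentially. (\<Sum>l | l < L n \<and> R < \<bar>\<xi> n l\<bar>. w n l) < e"
proof -
  obtain d where "d > 0" and d: "\<And>t. \<bar>t\<bar> < d \<Longrightarrow> cmod (\<rho> t - \<rho> 0) < e / 4"
    using cont[unfolded continuous_on_iff, rule_format, of 0 "e / 4"] \<open>0 < e\<close>
    by (auto simp: dist_norm)
  \<comment> \<open>Halving makes every \<open>t\<close> in \<open>{0..\<eta>}\<close> satisfy the
    strict bound \<open>\<bar>t\<bar> < d\<close>.\<close>
  define \<eta> where "\<eta> = d / 2"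
  define k where "k = (\<lambda>t. complex_of_real (indicator {0..\<eta>} t / \<eta>))"
  have \<eta>: "0 < \<eta>" "\<eta> < d"
    using \<open>d > 0\<close> by (auto simp: \<eta>_def)
  have "integrable lborel (\<lambda>t. indicator {0..\<eta>} t / \<eta>)"
    using integrable_real_indicator[of "{0..\<eta>}" lborel] \<eta>
    by (auto intro!: Bochner_Integration.integrable_divide)
  then have k: "integrable lborel k"
    unfolding k_def by (rule integrable_of_real)
  have kmeas: "(\<lambda>t. \<rho> (0 - t)) \<in> borel_measurable borel"
    by (intro borel_measurable_continuous_onI continuous_on_compose2[OF cont] continuous_intros) auto
  have k1: "(LINT t|lborel. k t) = 1"
    using \<eta> by (simp add: k_def integral_complex_of_real)
  have kabs: "(LINT t|lborel. cmod (k t) * (e / 4)) = e / 4"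
  proof -
    have "(LINT t|lborel. cmod (k t) * (e / 4)) = (LINT t|lborel. indicator {0..\<eta>} t / \<eta> * (e / 4))"
      using \<eta> by (intro Bochner_Integration.integral_cong) (auto simp: k_def norm_divide)
    also have "\<dots> = e / 4"
      using \<eta> by simp
    finally show ?thesis .
  qed
  have near: "cmod (k t * \<rho> (0 - t) - k t * \<rho> 0) \<le> cmod (k t) * (e / 4)" for t
  proof (cases "t \<in> {0..\<eta>}")
    case True
    then have "cmod (\<rho> (0 - t) - \<rho> 0) \<le> e / 4"
      using d[of "- t"] \<eta> by auto
    then have "cmod (k t) * cmod (\<rho> (0 - t) - \<rho> 0) \<le> cmod (k t) * (e / 4)"
      by (rule mult_left_mono) simp
    then show ?thesis
      by (simp only: right_diff_distrib[symmetric] norm_mult)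
  qed (simp add: k_def)
  have int: "integrable lborel (\<lambda>t. k t * \<rho> (0 - t))"
  proof -
    have "integrable lborel (\<lambda>t. k t * \<rho> (0 - t) - k t * \<rho> 0)"
      by (rule Bochner_Integration.integrable_bound[of _ "\<lambda>t. cmod (k t) * (e / 4)"])
        (use k kmeas near \<open>0 < e\<close> in auto)
    then show ?thesis
      using k Bochner_Integration.integrable_add[of lborel "\<lambda>t. k t * \<rho> (0 - t) - k t * \<rho> 0" "\<lambda>t. k t * \<rho> 0"] by simp
  qed
  have "cmod ((LINT t|lborel. k t * \<rho> (0 - t)) - \<rho> 0) = cmod (LINT t|lborel. k t * \<rho> (0 - t) - k t * \<rho> 0)"
    using int k by (simp add: k1)
  also have "\<dots> \<le> (LINT t|lborel. cmod (k t) * (e / 4))"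
    using int k near by (intro order_trans[OF integral_norm_bound] integral_mono) auto
  finally have "cmod ((LINT t|lborel. k t * \<rho> (0 - t)) - \<rho> 0) \<le> e / 4"
    by (simp only: kabs)
  then have "\<bar>Re ((LINT t|lborel. k t * \<rho> (0 - t)) - \<rho> 0)\<bar> \<le> e / 4"
    using abs_Re_le_cmod order_trans by blast
  then have small: "Re (\<rho> 0) - Re (LINT t|lborel. k t * \<rho> (0 - t)) < e / 2"
    using \<open>0 < e\<close> unfolding minus_complex.simps by linarith
  have "(\<lambda>n. Re (\<rho> 0) - Re (\<Sum>l<L n. w n l * fourier k (\<xi> n l) * cis (0 * \<xi> n l)))
      \<longlonglongrightarrow> Re (\<rho> 0) - Re (LINT t|lborel. k t * \<rho> (0 - t))"
    by (intro tendsto_intros lim_fourier k)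
  then have "\<forall>\<^sub>F n in sequentially.
      Re (\<rho> 0) - Re (\<Sum>l<L n. w n l * fourier k (\<xi> n l) * cis (0 * \<xi> n l)) < e / 2"
    using small by (rule order_tendstoD)
  then have "\<forall>\<^sub>F n in sequentially. (\<Sum>l | l < L n \<and> 4 / \<eta> < \<bar>\<xi> n l\<bar>. w n l) < e"
  proof eventually_elim
    case (elim n)
    have "(\<Sum>l | l < L n \<and> 4 / \<eta> < \<bar>\<xi> n l\<bar>. w n l)
        \<le> (\<Sum>l | l < L n \<and> 4 / \<eta> < \<bar>\<xi> n l\<bar>. 2 * (w n l * (1 - Re (fourier k (\<xi> n l)))))"
    proof (rule sum_mono)
      fix l
      assume "l \<in> {l. l < L n \<and> 4 / \<eta> < \<bar>\<xi> n l\<bar>}"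
      then have "Re (fourier k (\<xi> n l)) \<le> 1 / 2"
        using fourier_indicator_le(1)[OF \<eta>(1), of "\<xi> n l"] complex_Re_le_cmod[of "fourier k (\<xi> n l)"]
        by (simp add: k_def)
      then show "w n l \<le> 2 * (w n l * (1 - Re (fourier k (\<xi> n l))))"
        using mult_left_mono[of "1 / 2" "1 - Re (fourier k (\<xi> n l))" "w n l"] weight_nonneg[of n l]
        by simp
    qed
    \<comment> \<open>The added terms are nonnegative because \<open>fourier k\<close> has modulus
      at most 1.\<close>
    also have "\<dots> \<le> (\<Sum>l<L n. 2 * (w n l * (1 - Re (fourier k (\<xi> n l)))))"
    proof (rule sum_mono2)
      have "Re (fourier k x) \<le> 1" for x
        using fourier_indicator_le(2)[OF \<eta>(1), of x] complex_Re_le_cmod[of "fourier k x"]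
        by (simp add: k_def)
      then show "0 \<le> 2 * (w n l * (1 - Re (fourier k (\<xi> n l))))" for l
        using weight_nonneg[of n l] by simp
    qed auto
    also have "\<dots> = 2 * (Re (\<rho> 0) - Re (\<Sum>l<L n. w n l * fourier k (\<xi> n l) * cis (0 * \<xi> n l)))"
      by (simp add: sum_distrib_left[symmetric] right_diff_distrib sum_subtractf total_real)
    also have "\<dots> < e"
      using elim by simp
    finally show ?case .
  qed
  then show ?thesis
    using that by blast
qed

text \<open>Around each point of \<open>K\<close> the transform of some annihilator stays away from
  0, so by Chebyshev the mass there is at most a constant times an energy that tends to 0.
  Compactness leaves finitely many such neighbourhoods.\<close>

lemma compact_mass:
  assumes "compact K"
    and ann: "\<And>\<mu>. \<mu> \<in> K \<Longrightarrow> \<exists>f. integrable lborel f \<and> (\<forall>s. (LINT t|lborel. f t * \<rho> (s - t)) = 0) \<and> fourier f \<mu> \<noteq> 0"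
  shows "(\<lambda>n. \<Sum>l | l < L n \<and> \<xi> n l \<in> K. w n l) \<longlonglongrightarrow> 0"
proof -
  obtain f where f: "\<And>\<mu>. \<mu> \<in> K \<Longrightarrow> integrable lborel (f \<mu>)"
    and fann: "\<And>\<mu> s. \<mu> \<in> K \<Longrightarrow> (LINT t|lborel. f \<mu> t * \<rho> (s - t)) = 0"
    and fnz: "\<And>\<mu>. \<mu> \<in> K \<Longrightarrow> fourier (f \<mu>) \<mu> \<noteq> 0"
    using ann by metis
  \<comment> \<open>Half the value at \<open>\<mu>\<close>: positive, and small enough that
    \<open>\<mu>\<close> lies in its own set \<open>U \<mu>\<close>.\<close>
  define c where "c = (\<lambda>\<mu>. cmod (fourier (f \<mu>) \<mu>) / 2)"
  define U where "U = (\<lambda>\<mu>. {x. c \<mu> < cmod (fourier (f \<mu>) x)})"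
  have c: "0 < c \<mu>" if "\<mu> \<in> K" for \<mu>
    using fnz[OF that] by (simp add: c_def)
  obtain D where D: "D \<subseteq> K" "finite D" "K \<subseteq> (\<Union>\<mu>\<in>D. U \<mu>)"
  proof (rule compactE_image[OF \<open>compact K\<close>, of K U])
    show "open (U \<mu>)" if "\<mu> \<in> K" for \<mu>
      unfolding U_def by (intro open_Collect_less continuous_intros continuous_on_fourier f that)
    show "K \<subseteq> (\<Union>\<mu>\<in>K. U \<mu>)"
      using c by (force simp: U_def c_def)
  qed (use that in auto)
  define E where "E = (\<lambda>n. \<Sum>\<mu>\<in>D. (\<Sum>l<L n. w n l * (cmod (fourier (f \<mu>) (\<xi> n l)))\<^sup>2) / (c \<mu>)\<^sup>2)"
  have "E \<longlonglongrightarrow> (\<Sum>\<mu>\<in>D. 0 / (c \<mu>)\<^sup>2)"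
    unfolding E_def
    by (intro tendsto_sum tendsto_divide tendsto_const annihilator_energy)
      (use D f fann c in \<open>force+\<close>)
  then have E: "E \<longlonglongrightarrow> 0"
    by simp
  show ?thesis
  proof (rule tendsto_sandwich[OF _ _ tendsto_const E])
    show "\<forall>\<^sub>F n in sequentially. (\<Sum>l | l < L n \<and> \<xi> n l \<in> K. w n l) \<le> E n"
    proof (rule always_eventually, rule allI)
      fix n
      define S where "S = {l. l < L n \<and> \<xi> n l \<in> K}"
      \<comment> \<open>A node in \<open>K\<close> lies in some \<open>U \<mu>\<close>, and the
        corresponding summand alone already exceeds its weight.\<close>
      define e where "e = (\<lambda>l. \<Sum>\<mu>\<in>D. w n l * (cmod (fourier (f \<mu>) (\<xi> n l)))\<^sup>2 / (c \<mu>)\<^sup>2)"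
      have "w n l \<le> e l" if l: "l \<in> S" for l
      proof -
        obtain \<mu> where \<mu>: "\<mu> \<in> D" "c \<mu> < cmod (fourier (f \<mu>) (\<xi> n l))"
          using D(3)[THEN subsetD, of "\<xi> n l"] l by (auto simp: S_def U_def)
        have c0: "0 < c \<mu>"
          using c D(1) \<mu>(1) by blast
        then have "(c \<mu>)\<^sup>2 \<le> (cmod (fourier (f \<mu>) (\<xi> n l)))\<^sup>2"
          using \<mu>(2) by (intro power_mono) auto
        then have "w n l \<le> w n l * (cmod (fourier (f \<mu>) (\<xi> n l)))\<^sup>2 / (c \<mu>)\<^sup>2"
          using c0 weight_nonneg[of n l] by (simp add: field_simps mult_left_mono)
        also have "\<dots> \<le> e l"
          unfolding e_def using D(2) \<mu>(1) weight_nonneg by (intro member_le_sum) auto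
        finally show ?thesis .
      qed
      then have "(\<Sum>l\<in>S. w n l) \<le> (\<Sum>l\<in>S. e l)"
        by (rule sum_mono)
      also have "\<dots> \<le> (\<Sum>l<L n. e l)"
        by (rule sum_mono2) (auto simp: S_def e_def weight_nonneg intro!: sum_nonneg)
      also have "\<dots> = E n"
        unfolding e_def E_def by (subst sum.swap) (simp add: sum_divide_distrib)
      finally show "(\<Sum>l | l < L n \<and> \<xi> n l \<in> K. w n l) \<le> E n"
        unfolding S_def .
    qed
  qed (simp add: sum_nonneg weight_nonneg)
qed

text \<open>Frequencies up to \<open>\<beta>\<close> contribute at least
  \<open>cos (\<beta> * d)\<close> times their weight. Those between \<open>\<beta>\<close> and
  \<open>R\<close> lie in a compact set of vanishing mass, and those beyond \<open>R\<close> have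
  small mass. Taking \<open>\<beta>\<close> strictly above \<open>\<gamma>\<close> keeps the compact
  set inside the region where annihilators exist.\<close>

lemma Re_ge_cos:
  assumes ann: "\<And>\<mu>. \<gamma> < \<bar>\<mu>\<bar> \<Longrightarrow>
      \<exists>f. integrable lborel f \<and> (\<forall>s. (LINT t|lborel. f t * \<rho> (s - t)) = 0) \<and> fourier f \<mu> \<noteq> 0"
    and "0 \<le> d" "0 \<le> \<gamma>" "\<gamma> * d < pi"
  shows "cos (\<gamma> * d) * Re (\<rho> 0) \<le> Re (\<rho> d)"
proof -
  have *: "cos (\<beta> * d) * Re (\<rho> 0) - 4 * e \<le> Re (\<rho> d)" if \<beta>: "\<gamma> < \<beta>" "\<beta> * d \<le> pi" and "0 < e" for \<beta> e
  proof -
    obtain R where R: "\<forall>\<^sub>F n in sequentially. (\<Sum>l | l < L n \<and> R < \<bar>\<xi> n l\<bar>. w n l) < e"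
      using tail_mass[OF \<open>0 < e\<close>] .
    define K where "K = {-R..-\<beta>} \<union> {\<beta>..R}"
    have "(\<lambda>n. \<Sum>l | l < L n \<and> \<xi> n l \<in> K. w n l) \<longlonglongrightarrow> 0"
      by (rule compact_mass) (use ann \<beta> \<open>0 \<le> \<gamma>\<close> in \<open>auto simp: K_def intro!: compact_Un\<close>)
    then have "\<forall>\<^sub>F n in sequentially. (\<Sum>l | l < L n \<and> \<xi> n l \<in> K. w n l) < e"
      using \<open>0 < e\<close> by (rule order_tendstoD)
    then have "\<forall>\<^sub>F n in sequentially. cos (\<beta> * d) * Re (\<rho> 0) - 4 * e
        \<le> Re (\<Sum>l<L n. w n l * cis (d * \<xi> n l))"
      using R
    proof eventually_elim
      case (elim n)
      \<comment> \<open>Two cosines differ by at most 2; with two exceptional sets of mass below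
        \<open>e\<close> the total loss is below \<open>4 * e\<close>.\<close>
      have le: "w n l * cos (\<beta> * d) \<le> w n l * cos (d * \<xi> n l)
          + 2 * (if R < \<bar>\<xi> n l\<bar> then w n l else 0) + 2 * (if \<xi> n l \<in> K then w n l else 0)" for l
      proof (cases "\<bar>\<xi> n l\<bar> \<le> \<beta>")
        case True
        then have "cos (\<beta> * d) \<le> cos \<bar>d * \<xi> n l\<bar>"
          using \<beta> \<open>0 \<le> d\<close> by (intro cos_monotone_0_pi_le) (auto simp: abs_mult mult.commute[of d] mult_right_mono)
        then have "w n l * cos (\<beta> * d) \<le> w n l * cos (d * \<xi> n l)"
          by (intro mult_left_mono weight_nonneg) simp
        then show ?thesis
          using weight_nonneg[of n l] by auto
      next
        case False
        have "w n l * (cos (\<beta> * d) - cos (d * \<xi> n l)) \<le> w n l * 2"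
          using cos_le_one[of "\<beta> * d"] cos_ge_minus_one[of "d * \<xi> n l"]
          by (intro mult_left_mono weight_nonneg) linarith
        moreover have "R < \<bar>\<xi> n l\<bar> \<or> \<xi> n l \<in> K"
          using False by (auto simp: K_def)
        ultimately show ?thesis
          using weight_nonneg[of n l] by (auto simp: algebra_simps)
      qed
      have "cos (\<beta> * d) * Re (\<rho> 0) = (\<Sum>l<L n. w n l * cos (\<beta> * d))"
        by (simp add: total_real[of n, symmetric] sum_distrib_left mult.commute)
      also have "\<dots> \<le> (\<Sum>l<L n. w n l * cos (d * \<xi> n l)
          + 2 * (if R < \<bar>\<xi> n l\<bar> then w n l else 0) + 2 * (if \<xi> n l \<in> K then w n l else 0))"
        by (intro sum_mono le)
      also have "\<dots> = Re (\<Sum>l<L n. w n l * cis (d * \<xi> n l))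
          + 2 * (\<Sum>l | l < L n \<and> R < \<bar>\<xi> n l\<bar>. w n l) + 2 * (\<Sum>l | l < L n \<and> \<xi> n l \<in> K. w n l)"
      proof -
        have "(\<Sum>l | l < L n \<and> P l. w n l) = (\<Sum>l<L n. if P l then w n l else 0)" for P
          by (subst sum.inter_filter[symmetric]) (auto intro: sum.cong)
        then show ?thesis
          by (simp add: sum.distrib sum_distrib_left)
      qed
      finally show ?case
        using elim by linarith
    qed
    moreover have "(\<lambda>n. Re (\<Sum>l<L n. w n l * cis (d * \<xi> n l))) \<longlonglongrightarrow> Re (\<rho> d)"
      by (intro tendsto_intros lim)
    ultimately show ?thesis
      using tendsto_lowerbound trivial_limit_sequentially by blast
  qed
  \<comment> \<open>Let \<open>\<beta> = b n\<close> decrease to \<open>\<gamma>\<close>, with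
    \<open>e = b n - \<gamma>\<close> tending to 0 along with it; strictness of
    \<open>\<gamma> * d < pi\<close> leaves room for \<open>b n * d\<close>.\<close>
  define b where "b = (\<lambda>n::nat. \<gamma> + 1 / Suc n)"
  have b: "b \<longlonglongrightarrow> \<gamma>"
    unfolding b_def using LIMSEQ_inverse_real_of_nat_add[of \<gamma>] by (simp add: inverse_eq_divide)
  have "(\<lambda>n. b n * d) \<longlonglongrightarrow> \<gamma> * d"
    by (intro tendsto_intros b)
  then have "\<forall>\<^sub>F n in sequentially. b n * d < pi"
    using \<open>\<gamma> * d < pi\<close> by (rule order_tendstoD)
  then have "\<forall>\<^sub>F n in sequentially. cos (b n * d) * Re (\<rho> 0) - 4 * (b n - \<gamma>) \<le> Re (\<rho> d)"
    by eventually_elim (rule *, auto simp: b_def)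
  moreover have "(\<lambda>n. cos (b n * d) * Re (\<rho> 0) - 4 * (b n - \<gamma>)) \<longlonglongrightarrow> cos (\<gamma> * d) * Re (\<rho> 0) - 4 * (\<gamma> - \<gamma>)"
    by (intro tendsto_intros b)
  ultimately have "cos (\<gamma> * d) * Re (\<rho> 0) - 4 * (\<gamma> - \<gamma>) \<le> Re (\<rho> d)"
    using tendsto_upperbound trivial_limit_sequentially by blast
  then show ?thesis
    by simp
qed

end

section \<open>Isometric representations and Riesz bases\<close>


lemma isometric_rep_cinner:
  assumes T: "representation_on_reals T" and iso: "isometric_rep T"
  shows "cinner (T a y) (T b y) = cinner (T (a - b) y) y"
proof -
  \<comment> \<open>The common factor \<open>T b\<close> preserves inner products and can then be
    dropped.\<close>
  have "T a y = T b (T (a - b) y)"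
    using T unfolding representation_on_reals_def by (metis add.commute comp_apply diff_add_cancel)
  then show ?thesis
    using T iso isometry_cinner[of "T b"] by (simp add: representation_on_reals_def isometric_rep_def)
qed

text \<open>The double sum is the squared norm of the combination \<open>v\<close> of the orbit
  vectors \<open>T (t j) y\<close>.\<close>

lemma positive_definite_isometric_rep:
  assumes T: "representation_on_reals T" and iso: "isometric_rep T"
  shows "positive_definite (\<lambda>t. cinner (T t y) y)"
  unfolding positive_definite_def
proof (intro conjI allI)
  have "cinner y (T (- t) y) = cinner (T t y) y" for t
    using isometric_rep_cinner[OF T iso, of 0 y "- t"] T by (simp add: representation_on_reals_def)
  then show "cinner (T (- t) y) y = cnj (cinner (T t y) y)" for t
    by (metis cinner_commute)
  fix N :: nat and t :: "nat \<Rightarrow> real" and c :: "nat \<Rightarrow> complex"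
  define v where "v = (\<Sum>j<N. c j *\<^sub>C T (t j) y)"
  have "(\<Sum>j<N. \<Sum>k<N. c j * cnj (c k) * cinner (T (t j - t k) y) y) = cinner v v"
    unfolding v_def cinner_sum_left unfolding cinner_sum_right
    by (simp add: cinner_scaleC_left cinner_scaleC_right isometric_rep_cinner[OF T iso] mult_ac)
  then show "0 \<le> Re (\<Sum>j<N. \<Sum>k<N. c j * cnj (c k) * cinner (T (t j - t k) y) y)"
    by (simp add: cinner_self)
qed

text \<open>Pairing the vanishing vector integral with \<open>T (- s) y\<close> moves the shift by
  \<open>s\<close> into the correlation function and yields a vanishing convolution.\<close>

lemma beurling_spectrum_annihilator:
  assumes T: "representation_on_reals T" and iso: "isometric_rep T"
    and "\<mu> \<notin> beurling_spectrum T"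
  obtains f where "integrable lborel f" "fourier f \<mu> \<noteq> 0"
    "\<And>s. (LINT t|lborel. f t * cinner (T (s - t) y) y) = 0"
proof -
  obtain f where f: "integrable lborel f" "fourier f \<mu> \<noteq> 0" and act: "rep_action T f y 0"
    using assms(3) by (auto simp: beurling_spectrum_def)
  have "(LINT t|lborel. f t * cinner (T (s - t) y) y) = 0" for s
  proof -
    have "has_bochner_integral lborel (\<lambda>t. cinner (f t *\<^sub>C T (- t) y) (T (- s) y)) (cinner 0 (T (- s) y))"
      using act unfolding rep_action_def
      by (rule has_bochner_integral_bounded_linear_gen[OF bounded_linear_cinner])
    then show ?thesis
      by (simp add: cinner_scaleC_left isometric_rep_cinner[OF T iso] has_bochner_integral_integral_eq
          add.commute[of _ s])
  qed
  with f that show ?thesis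
    by blast
qed

text \<open>Every real outside \<open>{-\<gamma>..\<gamma>}\<close> has an annihilator whose
  transform is nonzero there, so \<open>Re_ge_cos\<close> applies to the correlation function of
  \<open>y\<close>, whose value at 0 is the squared norm.\<close>

lemma Re_cinner_ge_cos:
  assumes T: "representation_on_reals T" and iso: "isometric_rep T" and sc: "strongly_continuous T"
    and spec: "beurling_spectrum T \<subseteq> {-\<gamma>..\<gamma>}" and "0 \<le> \<gamma>" "0 \<le> d" "\<gamma> * d < pi"
  shows "cos (\<gamma> * d) * (norm y)\<^sup>2 \<le> Re (cinner (T d y) y)"
proof -
  define \<rho> where "\<rho> = (\<lambda>t. cinner (T t y) y)"
  have pd: "positive_definite \<rho>"
    unfolding \<rho>_def by (rule positive_definite_isometric_rep[OF T iso])
  have cont: "continuous_on UNIV \<rho>"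
    unfolding \<rho>_def using sc bounded_linear.continuous_on[OF bounded_linear_cinner]
    by (auto simp: strongly_continuous_def)
  obtain w \<xi> :: "nat \<Rightarrow> nat \<Rightarrow> real" and L where "\<And>n l. 0 \<le> w n l"
    "\<And>n. (\<Sum>l<L n. complex_of_real (w n l)) = \<rho> 0"
    "\<And>t. (\<lambda>n. \<Sum>l<L n. w n l * cis (t * \<xi> n l)) \<longlonglongrightarrow> \<rho> t"
    by (rule positive_definite_approx[OF pd cont]) (rule that)
  then interpret quadrature w \<xi> L \<rho>
    using cont by unfold_locales
  have "cos (\<gamma> * d) * Re (\<rho> 0) \<le> Re (\<rho> d)"
  proof (rule Re_ge_cos)
    fix \<mu>
    assume "\<gamma> < \<bar>\<mu>\<bar>"
    then have "\<mu> \<notin> beurling_spectrum T"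
      using spec by (auto dest!: subsetD)
    then show "\<exists>f. integrable lborel f \<and> (\<forall>s. (LINT t|lborel. f t * \<rho> (s - t)) = 0) \<and> fourier f \<mu> \<noteq> 0"
      using beurling_spectrum_annihilator[OF T iso, of \<mu> y] unfolding \<rho>_def by metis
  qed (use assms in auto)
  moreover have "\<rho> 0 = (norm y)\<^sup>2"
    using T by (simp add: \<rho>_def representation_on_reals_def cinner_self)
  ultimately show ?thesis
    by (simp add: \<rho>_def)
qed

section \<open>Riesz inequalities for pairs and the separation estimate\<close>

lemma riesz_basis_pair:
  assumes "riesz_basis \<phi> A B" "m \<noteq> n" "cmod z = 1"
  shows "2 * A \<le> (norm (\<phi> m + z *\<^sub>C \<phi> n))\<^sup>2" "(norm (\<phi> m + z *\<^sub>C \<phi> n))\<^sup>2 \<le> 2 * B"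
proof -
  \<comment> \<open>Two coefficients of modulus 1 on distinct indices, hence squared l2 norm 2; the
    values \<open>z = -1\<close> and \<open>z = 1\<close> are used later.\<close>
  define c where "c = (\<lambda>k. if k = m then 1 else if k = n then z else 0)"
  have s1: "((\<lambda>k. (cmod (c k))\<^sup>2) has_sum 2) UNIV"
    by (rule has_sum_finite_neutralI[of "{m, n}"]) (use assms in \<open>auto simp: c_def\<close>)
  have s2: "((\<lambda>k. c k *\<^sub>C \<phi> k) has_sum (\<phi> m + z *\<^sub>C \<phi> n)) UNIV"
    by (rule has_sum_finite_neutralI[of "{m, n}"]) (use assms in \<open>auto simp: c_def scaleC_one\<close>)
  have "A * (\<Sum>\<^sub>\<infinity>k. (cmod (c k))\<^sup>2) \<le> (norm (\<Sum>\<^sub>\<infinity>k. c k *\<^sub>C \<phi> k))\<^sup>2 \<and>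
      (norm (\<Sum>\<^sub>\<infinity>k. c k *\<^sub>C \<phi> k))\<^sup>2 \<le> B * (\<Sum>\<^sub>\<infinity>k. (cmod (c k))\<^sup>2)"
    using assms(1) has_sum_imp_summable[OF s1] unfolding riesz_basis_def by blast
  then show "2 * A \<le> (norm (\<phi> m + z *\<^sub>C \<phi> n))\<^sup>2" "(norm (\<phi> m + z *\<^sub>C \<phi> n))\<^sup>2 \<le> 2 * B"
    using infsumI[OF s1] infsumI[OF s2] by (simp_all add: mult.commute)
qed

text \<open>Substituting \<open>c = cos \<theta>\<close> and \<open>s = sin \<theta>\<close>, the claim is
  \<open>tan\<^sup>2 \<theta> \<le> 2 (1 - c) (1 + s)\<close> or, cancelling \<open>1 - c\<close>, \<open>1 + c \<le> 2 c\<^sup>2 (1 + s)\<close>;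
  equality holds at both ends of \<open>[0, \<pi>/4]\<close>.\<close>

lemma cos_ratio_le:
  fixes \<theta> :: real
  assumes "0 \<le> \<theta>" "\<theta> \<le> pi / 4"
  shows "1 - cos (2 * \<theta>) \<le> 2 * (1 - cos \<theta>) * (1 + sin \<theta>) * (1 + cos (2 * \<theta>))"
proof -
  define c s where "c = cos \<theta>" and "s = sin \<theta>"
  have sc: "s\<^sup>2 + c\<^sup>2 = 1"
    by (simp add: c_def s_def)
  have s0: "0 \<le> s"
    unfolding s_def using assms by (intro sin_ge_zero) auto
  have c1: "c \<le> 1" and c0: "0 < c"
    unfolding c_def using assms pi_gt_zero
    by (simp, intro cos_gt_zero_pi) linarith+
  have "sin \<theta> \<le> sin (pi / 4)" "cos (pi / 4) \<le> cos \<theta>"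
    using assms by (intro sin_monotone_2pi_le cos_monotone_0_pi_le; simp)+
  then have le: "s \<le> c"
    by (simp add: c_def s_def sin_45 cos_45)
  then have "s\<^sup>2 \<le> c\<^sup>2"
    using s0 by (rule power_mono)
  \<comment> \<open>From \<open>s \<le> c\<close> and \<open>s\<^sup>2 + c\<^sup>2 = 1\<close>
    follows \<open>1 \<le> 2 * c\<^sup>2\<close>.\<close>
  then have "c * 1 \<le> c * (2 * c\<^sup>2)"
    using sc c0 by (intro mult_left_mono) auto
  moreover have "(2 * c + 1) * s \<le> (2 * c + 1) * c"
    using le c0 by (intro mult_left_mono) auto
  ultimately have "(2 * c + 1) * s \<le> 2 * c\<^sup>2 * (1 + c)"
    by (simp add: algebra_simps power2_eq_square)
  \<comment> \<open>Multiplying by \<open>s\<close> makes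
    \<open>s\<^sup>2 = (1 + c) * (1 - c)\<close> available, whose factor \<open>1 + c\<close>
    cancels afterwards.\<close>
  then have "s * ((2 * c + 1) * s) \<le> s * (2 * c\<^sup>2 * (1 + c))"
    using s0 by (rule mult_left_mono)
  moreover have "s * ((2 * c + 1) * s) = (1 + c) * ((2 * c + 1) * (1 - c))"
  proof -
    have "s * s = (1 + c) * (1 - c)"
      using sc by (simp add: algebra_simps power2_eq_square)
    then show ?thesis
      by (metis mult.assoc mult.commute)
  qed
  ultimately have "(1 + c) * ((2 * c + 1) * (1 - c)) \<le> (1 + c) * (2 * c\<^sup>2 * s)"
    by (simp only: mult_ac)
  then have "(2 * c + 1) * (1 - c) \<le> 2 * c\<^sup>2 * s"
    using c0 by (simp only: mult_le_cancel_left)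
  then have "1 + c \<le> 2 * c\<^sup>2 * (1 + s)"
    by (simp add: algebra_simps power2_eq_square)
  then have "2 * (1 - c) * (1 + c) \<le> 2 * (1 - c) * (2 * c\<^sup>2 * (1 + s))"
    using c1 by (intro mult_left_mono) auto
  then show ?thesis
    unfolding cos_double_cos c_def[symmetric] s_def[symmetric]
    by (simp add: algebra_simps power2_eq_square)
qed

text \<open>This treats a single gap. Below \<open>pi / (2 * \<gamma>)\<close> the cosine of
  \<open>\<gamma> * d\<close> is nonnegative and \<open>\<gamma> * d / 2\<close> lies in the range
  of \<open>cos_ratio_le\<close>.\<close>

lemma riesz_bounds_ratio_le:
  assumes T: "representation_on_reals T" and iso: "isometric_rep T" and sc: "strongly_continuous T"
    and spec: "beurling_spectrum T \<subseteq> {-\<gamma>..\<gamma>}" and "0 < \<gamma>"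
    and riesz: "riesz_basis (\<lambda>n. T (\<Gamma> n) x) A B"
    and "m \<noteq> n" and d: "d = \<bar>\<Gamma> m - \<Gamma> n\<bar>" "d < pi / (2 * \<gamma>)"
  shows "A / B \<le> 2 * (1 - cos (\<gamma> * d / 2)) * (1 + sin (\<gamma> * d / 2))"
proof -
  \<comment> \<open>The two indices are ordered so that the time difference is nonnegative, as
    \<open>Re_cinner_ge_cos\<close> requires.\<close>
  have gap: "?thesis" if "m \<noteq> n" and d: "d = \<Gamma> m - \<Gamma> n" "0 \<le> d" for m n
  proof -
    let ?u = "T (\<Gamma> m) x" and ?v = "T (\<Gamma> n) x"
    define C where "C = cos (\<gamma> * d)"
    define r where "r = Re (cinner ?u ?v)"
    have gd: "0 \<le> \<gamma> * d" "\<gamma> * d \<le> pi / 2"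
      using \<open>d < pi / (2 * \<gamma>)\<close> \<open>0 < \<gamma>\<close> \<open>0 \<le> d\<close> by (simp_all add: field_simps)
    have AB: "0 < A" "A \<le> B"
      using riesz by (auto simp: riesz_basis_def)
    have nu: "norm ?u = norm x" "norm ?v = norm x"
      using iso by (auto simp: isometric_rep_def)
    have "C * (norm x)\<^sup>2 \<le> r"
      unfolding C_def r_def isometric_rep_cinner[OF T iso] d(1)[symmetric]
      using gd \<open>0 < \<gamma>\<close> d(2) pi_gt_zero by (intro Re_cinner_ge_cos T iso sc spec) linarith+
    moreover have "2 * A \<le> 2 * (norm x)\<^sup>2 - 2 * r"
      using riesz_basis_pair(1)[OF riesz \<open>m \<noteq> n\<close>, of "-1"] norm_diff_sq[of ?u ?v]
      by (simp add: r_def nu scaleC_minus_one)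
    moreover have "2 * (norm x)\<^sup>2 + 2 * r \<le> 2 * B"
      using riesz_basis_pair(2)[OF riesz \<open>m \<noteq> n\<close>, of 1] norm_add_sq[of ?u ?v]
      by (simp add: r_def nu scaleC_one)
    ultimately have le: "A \<le> (1 - C) * (norm x)\<^sup>2" "(1 + C) * (norm x)\<^sup>2 \<le> B"
      by (auto simp: algebra_simps)
    have C: "0 \<le> C" "C \<le> 1"
      using gd by (auto simp: C_def cos_ge_zero)
    \<comment> \<open>Cross-multiplication eliminates the unknown norm of \<open>x\<close> from the
      two inequalities.\<close>
    have "A * (1 + C) \<le> (1 - C) * (norm x)\<^sup>2 * (1 + C)"
      using le(1) C by (intro mult_right_mono) auto
    also have "\<dots> = (1 - C) * ((1 + C) * (norm x)\<^sup>2)"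
      by simp
    also have "\<dots> \<le> (1 - C) * B"
      using le(2) C by (intro mult_left_mono) auto
    also have "\<dots> \<le> 2 * (1 - cos (\<gamma> * d / 2)) * (1 + sin (\<gamma> * d / 2)) * (1 + C) * B"
      using cos_ratio_le[of "\<gamma> * d / 2"] gd AB by (intro mult_right_mono) (auto simp: C_def)
    finally have "(1 + C) * A \<le> (1 + C) * (2 * (1 - cos (\<gamma> * d / 2)) * (1 + sin (\<gamma> * d / 2)) * B)"
      by (simp only: mult_ac)
    then have "A \<le> 2 * (1 - cos (\<gamma> * d / 2)) * (1 + sin (\<gamma> * d / 2)) * B"
      using C by (simp add: mult_le_cancel_left)
    then show ?thesis
      using AB by (simp add: pos_divide_le_eq)
  qed
  show ?thesis
    using gap[of m n] gap[of n m] \<open>m \<noteq> n\<close> d(1) by (cases "\<Gamma> n \<le> \<Gamma> m") auto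
qed

theorem corollary1p2:
  fixes T :: "real \<Rightarrow> 'a::chilbert_space \<Rightarrow> 'a"
    and \<gamma> A B \<kappa> :: real
    and x :: 'a
    and \<Gamma> :: "int \<Rightarrow> real"
  assumes "representation_on_reals T"
    and "isometric_rep T"
    and "strongly_continuous T"
    and "\<gamma> > 0"
    and "beurling_spectrum T \<subseteq> {-\<gamma>..\<gamma>}"
    and "riesz_basis (\<lambda>n. T (\<Gamma> n) x) A B"
  defines "\<kappa> \<equiv> Inf {\<bar>\<Gamma> m - \<Gamma> n\<bar> | m n. m \<noteq> n}"
  shows "2 * (1 - cos (\<gamma> * \<kappa> / 2)) * (1 + sin (\<gamma> * \<kappa> / 2)) \<ge> A / B \<or> \<kappa> \<ge> pi / (2 * \<gamma>)"
proof (rule disjCI)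
  assume "\<not> pi / (2 * \<gamma>) \<le> \<kappa>"
  define D where "D = {\<bar>\<Gamma> m - \<Gamma> n\<bar> | m n. m \<noteq> n}"
  define G where "G = (\<lambda>d. 2 * (1 - cos (\<gamma> * d / 2)) * (1 + sin (\<gamma> * d / 2)))"
  have "\<bar>\<Gamma> 0 - \<Gamma> 1\<bar> \<in> D"
    unfolding D_def by force
  then have "D \<noteq> {}"
    by blast
  moreover have "bdd_below D"
    by (rule bdd_belowI[of _ 0]) (auto simp: D_def)
  \<comment> \<open>The infimum need not be attained, so the bound is proved for gaps converging to
    \<open>\<kappa>\<close>, which are eventually below \<open>pi / (2 * \<gamma>)\<close>, and
    passes to the limit by continuity of \<open>G\<close>.\<close>
  ultimately have "\<kappa> \<in> closure D"
    unfolding \<kappa>_def D_def[symmetric] by (rule closure_contains_Inf)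
  then obtain d where d: "\<And>i. d i \<in> D" and lim: "d \<longlonglongrightarrow> \<kappa>"
    unfolding closure_sequential by blast
  have "\<forall>\<^sub>F i in sequentially. d i < pi / (2 * \<gamma>)"
    using lim \<open>\<not> pi / (2 * \<gamma>) \<le> \<kappa>\<close> by (intro order_tendstoD) auto
  then have "\<forall>\<^sub>F i in sequentially. A / B \<le> G (d i)"
  proof eventually_elim
    case (elim i)
    obtain m n where "m \<noteq> n" "d i = \<bar>\<Gamma> m - \<Gamma> n\<bar>"
      using d[of i] by (auto simp: D_def)
    then show ?case
      unfolding G_def using riesz_bounds_ratio_le[OF assms(1-3,5,4,6)] elim by blast
  qed
  moreover have "(\<lambda>i. G (d i)) \<longlonglongrightarrow> G \<kappa>"
    unfolding G_def by (intro tendsto_intros lim) auto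
  ultimately have "A / B \<le> G \<kappa>"
    using tendsto_lowerbound trivial_limit_sequentially by blast
  then show "A / B \<le> 2 * (1 - cos (\<gamma> * \<kappa> / 2)) * (1 + sin (\<gamma> * \<kappa> / 2))"
    by (simp add: G_def)
qed

end
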